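(* Let $L(x)=c_1x_1+\cdots+c_tx_t$ be a linear form with non-zero integer coefficients in $t\geq 3$ variables, and let $G$ be a compact abelian group such that $c_i\cdot G=G$ for every $i\in\{1,\dots,t\}$. Then for any $f_1,\ldots,f_t\in \mathcal{L}_2(G)$, \[ |S_L(f_1,\ldots,f_t)|\leq \min_{i\in \{1,\dots,t\}}\; \|f_i\|_{U^2} \prod_{j\neq i} \|f_j\|_{\mathcal{L}_2}. \]
   Context: $c\cdot G$ denotes the image of $G$ under the dilation $x\mapsto cx$. $\mathcal{L}_2(G)$ is the space of square-integrable complex functions with respect to the normalized Haar measure on $G$. Let $\ker L=\{x\in G^t: L(x)=0\}$ and $\mu_L$ its Haar probability measure; $S_L(f_1,\dots,f_t)=\int_{\ker L} f_1(x_1)\cdots f_t(x_t)\,d\mu_L(x)$. The $U^2$ norm is given by $\|f\|_{U^2}^4=\int_{G^4} f(x+y)\overline{f(x+y')}\,\overline{f(x'+y)}f(x'+y')\,dx\,dx'\,dy\,dy'$ (normalized Haar measure). *)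

theory Defs
  imports "HOL-Probability.Probability"
begin

primrec nat_mult :: "nat \<Rightarrow> 'a::ab_group_add \<Rightarrow> 'a" where
  "nat_mult 0 x = 0"
| "nat_mult (Suc n) x = x + nat_mult n x"

definition int_mult :: "int \<Rightarrow> 'a::ab_group_add \<Rightarrow> 'a" where
  "int_mult c x = (if 0 \<le> c then nat_mult (nat c) x else - nat_mult (nat (- c)) x)"

definition linear_form :: "('n \<Rightarrow> int) \<Rightarrow> 'a::ab_group_add ^ 'n \<Rightarrow> 'a" where
  "linear_form c x = (\<Sum>i\<in>UNIV. int_mult (c i) (x $ i))"

definition form_kernel :: "('n \<Rightarrow> int) \<Rightarrow> ('a::ab_group_add ^ 'n) set" where
  "form_kernel c = {x. linear_form c x = 0}"

(* Intended for K a compact subgroup of a Hausdorff abelian group (K = UNIV being the group itself).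
   Regularity is part of the notion: without second countability it is what makes the
   translation-invariant Borel probability measure unique.
   The sigma-algebra consists of the Borel sets of K. In particular, on a product of groups it is the
   Borel sigma-algebra of the product topology, which may be strictly larger than the product of
   the Borel sigma-algebras (addition may fail to be measurable for the latter). *)
definition haar_probability ::
  "'g::{topological_space,ab_group_add} set \<Rightarrow> 'g measure \<Rightarrow> bool" where
  "haar_probability K \<mu> \<longleftrightarrow>
     sets \<mu> = sets (restrict_space borel K) \<and>
     prob_space \<mu> \<and>
     (\<forall>a\<in>K. \<forall>A\<in>sets \<mu>. emeasure \<mu> ((+) a ` A) = emeasure \<mu> A) \<and>
     (\<forall>A\<in>sets \<mu>. emeasure \<mu> A = (INF U\<in>{U. open U \<and> A \<subseteq> U}. emeasure \<mu> (U \<inter> K))) \<and>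
     (\<forall>A\<in>sets \<mu>. emeasure \<mu> A = (SUP C\<in>{C. compact C \<and> C \<subseteq> A}. emeasure \<mu> C))"

definition L2_space :: "'g measure \<Rightarrow> ('g \<Rightarrow> complex) set" where
  "L2_space \<mu> = {f \<in> borel_measurable \<mu>. integrable \<mu> (\<lambda>x. (cmod (f x))\<^sup>2)}"

definition L2_norm :: "'g measure \<Rightarrow> ('g \<Rightarrow> complex) \<Rightarrow> real" where
  "L2_norm \<mu> f = sqrt (\<integral>x. (cmod (f x))\<^sup>2 \<partial>\<mu>)"

(* \<nu> is the Haar probability measure on the fourth power of the group. The integral is a
   non-negative real number; Re only converts it to type real. *)
definition U2_norm :: "('g \<times> 'g \<times> 'g \<times> 'g) measure \<Rightarrow> ('g::ab_group_add \<Rightarrow> complex) \<Rightarrow> real" where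
  "U2_norm \<nu> f = root 4 (Re (\<integral>(x, x', y, y').
      f (x + y) * cnj (f (x + y')) * cnj (f (x' + y)) * f (x' + y') \<partial>\<nu>))"

(* \<kappa> is the Haar probability measure on the kernel of the linear form, so its space is that kernel. *)
definition solution_integral ::
  "('a ^ 'n) measure \<Rightarrow> ('n::finite \<Rightarrow> 'a \<Rightarrow> complex) \<Rightarrow> complex" where
  "solution_integral \<kappa> f = (\<integral>x. (\<Prod>i\<in>UNIV. f i (x $ i)) \<partial>\<kappa>)"

end

theory Submission
  imports Defs
begin

text \<open>No Fourier analysis is used. Haar measure on the kernel is invariant under translation by the
  vectors with entries \<open>- c\<^sub>j u\<close> in place \<open>i\<close>, \<open>c\<^sub>i u\<close> in place \<open>j\<close> and \<open>0\<close> elsewhere, so the integral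
  is unchanged when the integrand is averaged over \<open>u\<close>. Averaging over two such directions, through
  \<open>j\<close> and \<open>k\<close>, replaces the factors \<open>i, j, k\<close> by a double integral of
  \<open>f\<^sub>i (x\<^sub>i - c\<^sub>j y - c\<^sub>k z) f\<^sub>j (x\<^sub>j + c\<^sub>i y) f\<^sub>k (x\<^sub>k + c\<^sub>i z)\<close>, which two applications of Cauchy-Schwarz bound by the
  \<open>U\<^sup>2\<close> norm of \<open>f\<^sub>i\<close> and the \<open>L\<^sup>2\<close> norms of \<open>f\<^sub>j\<close> and \<open>f\<^sub>k\<close>, uniformly in \<open>x\<close>; surjectivity of
  \<open>x \<mapsto> c\<^sub>i x\<close> is what makes these dilations preserve Haar measure. The remaining coordinates are
  independent, which gives the other \<open>L\<^sup>2\<close> norms. As the group need not be second countable, Fubini's theorem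
  is available only for continuous functions, and square-integrable ones are reached by density: both
  the solution integral and the \<open>U\<^sup>2\<close> integral are multilinear forms bounded by products of
  \<open>L\<^sup>2\<close> norms.\<close>

section \<open>Square-integrable functions\<close>

text \<open>The measures \<open>\<kappa>\<close> and \<open>\<nu>\<close> live on Borel
  sigma-algebras of product topologies, which may exceed the product sigma-algebras, so they are not
  treated as product measures: what is available is invariance and regularity. Information about
  them is extracted in two ways, by averaging over translations with a parameter distributed
  according to \<open>\<mu>\<close>, and by pushing forward along a continuous homomorphism onto the
  group, where uniqueness of Haar measure identifies the image with \<open>\<mu>\<close>. A second
  obstacle is that a product of three or more square-integrable functions has no evident reason to
  be integrable over the kernel. Hence the inequality for continuous functions comes first, and
  integrability is deduced from it. The extension needs a bound that is symmetric in the functions;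
  it results from the asymmetric one because the U^2 norm of a continuous function is at most its
  L^2 norm.\<close>

lemma norm_integral_le_integral:
  fixes f :: "'a \<Rightarrow> 'b::{banach,second_countable_topology}"
  assumes "integrable M f" "integrable M g" "\<And>x. x \<in> space M \<Longrightarrow> norm (f x) \<le> g x"
  shows "norm (\<integral>x. f x \<partial>M) \<le> (\<integral>x. g x \<partial>M)"
  by (rule order_trans[OF integral_norm_bound]) (intro integral_mono integrable_norm assms)

lemma L2_space_iff:
  "f \<in> L2_space M \<longleftrightarrow> f \<in> borel_measurable M \<and> integrable M (\<lambda>x. (cmod (f x))\<^sup>2)"
  by (simp add: L2_space_def)

lemma L2_norm_nonneg: "0 \<le> L2_norm M f"
  by (simp add: L2_norm_def)

lemma L2_norm_power2: "(L2_norm M f)\<^sup>2 = (\<integral>x. (cmod (f x))\<^sup>2 \<partial>M)"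
  by (simp add: L2_norm_def)

lemma L2_space_mult_integrable:
  assumes "f \<in> L2_space M" "g \<in> L2_space M"
  shows "integrable M (\<lambda>x. f x * g x)"
proof (rule Bochner_Integration.integrable_bound)
  show "integrable M (\<lambda>x. (cmod (f x))\<^sup>2 + (cmod (g x))\<^sup>2)"
    using assms by (auto simp: L2_space_iff)
  show "(\<lambda>x. f x * g x) \<in> borel_measurable M"
    using assms by (auto simp: L2_space_iff)
  have "a * b \<le> a\<^sup>2 + b\<^sup>2" if "0 \<le> a" "0 \<le> b" for a b :: real
    using sum_squares_bound[of a b] mult_nonneg_nonneg[OF that] by linarith
  then show "AE x in M. norm (f x * g x) \<le> norm ((cmod (f x))\<^sup>2 + (cmod (g x))\<^sup>2)"
    by (auto simp: norm_mult)
qed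

lemma L2_norm_norm: "L2_norm M (\<lambda>x. complex_of_real (cmod (f x))) = L2_norm M f"
  by (simp add: L2_norm_def)

lemma borel_measurable_cnj:
  assumes "f \<in> borel_measurable M"
  shows "(\<lambda>x. cnj (f x)) \<in> borel_measurable M"
  by (intro measurable_compose[OF assms] borel_measurable_continuous_onI continuous_intros)

lemma L2_space_cnj: "f \<in> L2_space M \<Longrightarrow> (\<lambda>x. cnj (f x)) \<in> L2_space M"
  by (auto simp: L2_space_iff intro: borel_measurable_cnj)

lemma L2_norm_cnj: "L2_norm M (\<lambda>x. cnj (f x)) = L2_norm M f"
  by (simp add: L2_norm_def)

lemma L2_norm_Cauchy_Schwarz:
  assumes f: "f \<in> L2_space M" and g: "g \<in> L2_space M"
  shows "(\<integral>x. cmod (f x) * cmod (g x) \<partial>M) \<le> L2_norm M f * L2_norm M g"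
proof -
  have [measurable]: "f \<in> borel_measurable M" "g \<in> borel_measurable M"
    using f g by (auto simp: L2_space_iff)
  let ?A = "\<integral>x. (cmod (f x))\<^sup>2 \<partial>M" and ?B = "\<integral>x. (cmod (g x))\<^sup>2 \<partial>M"
    and ?C = "\<integral>x. cmod (f x) * cmod (g x) \<partial>M"
  have i: "integrable M (\<lambda>x. cmod (f x) * cmod (g x))"
    using integrable_norm[OF L2_space_mult_integrable[OF f g]] by (simp add: norm_mult)
  have "(\<integral>\<^sup>+x. ennreal (cmod (f x)) * ennreal (cmod (g x)) \<partial>M)\<^sup>2
      \<le> (\<integral>\<^sup>+x. (ennreal (cmod (f x)))\<^sup>2 \<partial>M) * (\<integral>\<^sup>+x. (ennreal (cmod (g x)))\<^sup>2 \<partial>M)"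
    by (rule Cauchy_Schwarz_nn_integral) auto
  also have "(\<integral>\<^sup>+x. (ennreal (cmod (f x)))\<^sup>2 \<partial>M) = ennreal ?A"
    using f by (subst nn_integral_eq_integral[symmetric]) (auto simp: L2_space_iff ennreal_power)
  also have "(\<integral>\<^sup>+x. (ennreal (cmod (g x)))\<^sup>2 \<partial>M) = ennreal ?B"
    using g by (subst nn_integral_eq_integral[symmetric]) (auto simp: L2_space_iff ennreal_power)
  also have "(\<integral>\<^sup>+x. ennreal (cmod (f x)) * ennreal (cmod (g x)) \<partial>M) = ennreal ?C"
    using i by (subst nn_integral_eq_integral[symmetric]) (auto simp: ennreal_mult)
  finally have "ennreal (?C\<^sup>2) \<le> ennreal (?A * ?B)"
    by (simp add: ennreal_power ennreal_mult)
  then have "?C\<^sup>2 \<le> ?A * ?B"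
    by (subst (asm) ennreal_le_iff) auto
  then have "?C \<le> sqrt (?A * ?B)"
    by (rule real_le_rsqrt)
  then show ?thesis
    by (simp add: L2_norm_def real_sqrt_mult)
qed

lemma norm_integral_mult_le_L2:
  assumes f: "f \<in> L2_space M" and g: "g \<in> L2_space M"
  shows "cmod (\<integral>x. f x * g x \<partial>M) \<le> L2_norm M f * L2_norm M g"
proof -
  have "cmod (\<integral>x. f x * g x \<partial>M) \<le> (\<integral>x. cmod (f x * g x) \<partial>M)"
    by (rule integral_norm_bound)
  then show ?thesis
    using L2_norm_Cauchy_Schwarz[OF f g] by (simp add: norm_mult)
qed

lemma L2_space_add:
  assumes f: "f \<in> L2_space M" and g: "g \<in> L2_space M"
  shows "(\<lambda>x. f x + g x) \<in> L2_space M"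
  unfolding L2_space_iff
proof
  show m: "(\<lambda>x. f x + g x) \<in> borel_measurable M"
    using assms by (auto simp: L2_space_iff)
  show "integrable M (\<lambda>x. (cmod (f x + g x))\<^sup>2)"
  proof (rule Bochner_Integration.integrable_bound)
    show "integrable M (\<lambda>x. 2 * (cmod (f x))\<^sup>2 + 2 * (cmod (g x))\<^sup>2)"
      using assms by (auto simp: L2_space_iff)
    have "(cmod (a + b))\<^sup>2 \<le> 2 * (cmod a)\<^sup>2 + 2 * (cmod b)\<^sup>2" for a b
    proof -
      have "(cmod (a + b))\<^sup>2 \<le> (cmod a + cmod b)\<^sup>2"
        by (intro power_mono norm_triangle_ineq) auto
      also have "\<dots> \<le> 2 * (cmod a)\<^sup>2 + 2 * (cmod b)\<^sup>2"
        using sum_squares_bound[of "cmod a" "cmod b"] by (simp add: power2_sum)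
      finally show ?thesis .
    qed
    then show "AE x in M. norm ((cmod (f x + g x))\<^sup>2)
        \<le> norm (2 * (cmod (f x))\<^sup>2 + 2 * (cmod (g x))\<^sup>2)"
      by auto
  qed (use m in measurable)
qed

lemma L2_space_cmult: "f \<in> L2_space M \<Longrightarrow> (\<lambda>x. c * f x) \<in> L2_space M"
  by (auto simp: L2_space_iff norm_mult power_mult_distrib)

lemma L2_norm_cmult: "L2_norm M (\<lambda>x. c * f x) = cmod c * L2_norm M f"
  by (simp add: L2_norm_def norm_mult power_mult_distrib real_sqrt_mult)

lemma L2_space_diff: "f \<in> L2_space M \<Longrightarrow> g \<in> L2_space M \<Longrightarrow> (\<lambda>x. f x - g x) \<in> L2_space M"
  using L2_space_add[OF _ L2_space_cmult[of g M "-1"], of f] by simp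

lemma L2_norm_triangle:
  assumes f: "f \<in> L2_space M" and g: "g \<in> L2_space M"
  shows "L2_norm M (\<lambda>x. f x + g x) \<le> L2_norm M f + L2_norm M g"
proof -
  have i: "integrable M (\<lambda>x. cmod (f x) * cmod (g x))"
    using integrable_norm[OF L2_space_mult_integrable[OF f g]] by (simp add: norm_mult)
  have "(L2_norm M (\<lambda>x. f x + g x))\<^sup>2
      \<le> (\<integral>x. (cmod (f x))\<^sup>2 + (cmod (g x))\<^sup>2 + 2 * (cmod (f x) * cmod (g x)) \<partial>M)"
    unfolding L2_norm_power2
  proof (rule integral_mono)
    show "integrable M (\<lambda>x. (cmod (f x + g x))\<^sup>2)"
      using L2_space_add[OF f g] by (simp add: L2_space_iff)
    show "integrable M (\<lambda>x. (cmod (f x))\<^sup>2 + (cmod (g x))\<^sup>2 + 2 * (cmod (f x) * cmod (g x)))"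
      using f g i by (auto simp: L2_space_iff)
    fix x
    have "(cmod (f x + g x))\<^sup>2 \<le> (cmod (f x) + cmod (g x))\<^sup>2"
      by (intro power_mono norm_triangle_ineq) auto
    then show "(cmod (f x + g x))\<^sup>2
        \<le> (cmod (f x))\<^sup>2 + (cmod (g x))\<^sup>2 + 2 * (cmod (f x) * cmod (g x))"
      by (simp add: power2_sum)
  qed
  also have "\<dots> = (L2_norm M f)\<^sup>2 + (L2_norm M g)\<^sup>2
      + 2 * (\<integral>x. cmod (f x) * cmod (g x) \<partial>M)"
    using f g i by (simp add: L2_space_iff L2_norm_power2)
  also have "\<dots> \<le> (L2_norm M f + L2_norm M g)\<^sup>2"
    using L2_norm_Cauchy_Schwarz[OF f g] by (simp add: power2_sum)
  finally show ?thesis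
    by (rule power2_le_imp_le) (simp add: L2_norm_nonneg)
qed

lemma L2_norm_minus_commute: "L2_norm M (\<lambda>x. f x - g x) = L2_norm M (\<lambda>x. g x - f x)"
  by (simp add: L2_norm_def norm_minus_commute)

text \<open>The reverse triangle inequality, obtained from two applications of the triangle
  inequality.\<close>

lemma tendsto_L2_norm:
  assumes F: "\<And>n. F n \<in> L2_space M" and f: "f \<in> L2_space M"
    and lim: "(\<lambda>n. L2_norm M (\<lambda>x. F n x - f x)) \<longlonglongrightarrow> 0"
  shows "(\<lambda>n. L2_norm M (F n)) \<longlonglongrightarrow> L2_norm M f"
proof -
  have "\<bar>L2_norm M (F n) - L2_norm M f\<bar> \<le> L2_norm M (\<lambda>x. F n x - f x)" for n
    using L2_norm_triangle[OF L2_space_diff[OF F[of n] f] f]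
      L2_norm_triangle[OF L2_space_diff[OF f F[of n]] F[of n]]
      L2_norm_minus_commute[of M "F n" f] by simp
  then have "(\<lambda>n. L2_norm M (F n) - L2_norm M f) \<longlonglongrightarrow> 0"
    by (intro Lim_null_comparison[OF always_eventually lim]) simp
  then show ?thesis
    by (simp add: LIM_zero_iff)
qed

lemma (in finite_measure) L2_space_bounded:
  assumes "f \<in> borel_measurable M" "\<And>x. cmod (f x) \<le> B"
  shows "f \<in> L2_space M"
  unfolding L2_space_iff
proof
  show "integrable M (\<lambda>x. (cmod (f x))\<^sup>2)"
    by (rule integrable_const_bound[where B = "B\<^sup>2"])
      (use assms in \<open>auto intro!: power_mono\<close>)
qed fact

lemma (in prob_space) integral_norm_le_L2_norm:
  assumes "f \<in> L2_space M"
  shows "(\<integral>x. cmod (f x) \<partial>M) \<le> L2_norm M f"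
proof -
  have "(\<lambda>x. 1) \<in> L2_space M"
    by (rule L2_space_bounded[of _ 1]) auto
  from L2_norm_Cauchy_Schwarz[OF assms this] show ?thesis
    by (simp add: L2_norm_def prob_space)
qed

text \<open>Bochner approximation by simple functions turns density of a subspace into a question about indicators.\<close>

lemma (in finite_measure) L2_dense_induct:
  assumes f: "f \<in> L2_space M"
    and sub: "\<And>g. P g \<Longrightarrow> g \<in> L2_space M"
    and zero: "P (\<lambda>x. 0)"
    and add: "\<And>g h. P g \<Longrightarrow> P h \<Longrightarrow> P (\<lambda>x. g x + h x)"
    and cmult: "\<And>g c. P g \<Longrightarrow> P (\<lambda>x. c * g x)"
    and ind: "\<And>A e. A \<in> sets M \<Longrightarrow> 0 < e \<Longrightarrow> \<exists>g. P g \<and> L2_norm M (\<lambda>x. g x - indicator A x) < e"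
    and e: "0 < e"
  shows "\<exists>g. P g \<and> L2_norm M (\<lambda>x. g x - f x) < e"
proof -
  \<comment> \<open>\<open>Q\<close> says that \<open>h\<close> lies in the L^2 closure of
    \<open>P\<close>. The closure is again a linear space, so containing the indicators it contains
    all simple functions.\<close>
  define Q where "Q h \<longleftrightarrow> h \<in> L2_space M \<and> (\<forall>e>0. \<exists>g. P g \<and> L2_norm M (\<lambda>x. g x - h x) < e)" for h
  have Q0: "Q (\<lambda>x. 0)"
    unfolding Q_def using sub[OF zero] zero by (auto intro!: exI[of _ "\<lambda>x. 0"] simp: L2_norm_def)
  have Qadd: "Q (\<lambda>x. g x + h x)" if g: "Q g" and h: "Q h" for g h
    unfolding Q_def
  proof (intro conjI allI impI)
    show "(\<lambda>x. g x + h x) \<in> L2_space M"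
      using g h by (auto simp: Q_def intro: L2_space_add)
    fix e :: real assume "0 < e"
    then obtain g' h' where *: "P g'" "P h'" "L2_norm M (\<lambda>x. g' x - g x) < e / 2"
      "L2_norm M (\<lambda>x. h' x - h x) < e / 2"
      using g h unfolding Q_def by (meson half_gt_zero)
    have "L2_norm M (\<lambda>x. (g' x - g x) + (h' x - h x)) < e"
      using L2_norm_triangle[of "\<lambda>x. g' x - g x" M "\<lambda>x. h' x - h x"] * g h
      by (force intro: L2_space_diff sub simp: Q_def)
    then show "\<exists>k. P k \<and> L2_norm M (\<lambda>x. k x - (g x + h x)) < e"
      using add[OF *(1,2)] by (intro exI[of _ "\<lambda>x. g' x + h' x"]) (simp add: algebra_simps)
  qed
  have Qcmult: "Q (\<lambda>x. c * g x)" if g: "Q g" for g c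
    unfolding Q_def
  proof (intro conjI allI impI)
    show "(\<lambda>x. c * g x) \<in> L2_space M"
      using g by (auto simp: Q_def intro: L2_space_cmult)
    fix e :: real assume "0 < e"
    \<comment> \<open>Adding 1 keeps the denominator positive when \<open>c = 0\<close>.\<close>
    then have "0 < e / (cmod c + 1)"
      by (intro divide_pos_pos) (auto simp: add_nonneg_pos)
    then obtain g' where *: "P g'" "L2_norm M (\<lambda>x. g' x - g x) < e / (cmod c + 1)"
      using g unfolding Q_def by meson
    have "L2_norm M (\<lambda>x. c * (g' x - g x)) \<le> (cmod c + 1) * L2_norm M (\<lambda>x. g' x - g x)"
      unfolding L2_norm_cmult by (intro mult_right_mono) (auto simp: L2_norm_nonneg)
    also have "\<dots> < (cmod c + 1) * (e / (cmod c + 1))"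
      using * by (intro mult_strict_left_mono) (auto simp: add_nonneg_pos)
    also have "\<dots> = e"
      using norm_ge_zero[of c] by (simp add: add_nonneg_eq_0_iff)
    finally show "\<exists>k. P k \<and> L2_norm M (\<lambda>x. k x - c * g x) < e"
      using cmult[OF *(1)] by (intro exI[of _ "\<lambda>x. c * g' x"]) (simp add: algebra_simps)
  qed
  have Qind: "Q (indicator A)" if A: "A \<in> sets M" for A
    unfolding Q_def using A ind
    by (auto intro!: L2_space_bounded[of _ 1] simp: indicator_def)
  have Qsum: "Q (\<lambda>x. \<Sum>v\<in>V. v * indicator (A v) x)"
    if "finite V" "\<And>v. v \<in> V \<Longrightarrow> A v \<in> sets M" for V A
    using that
  proof (induction V rule: finite_induct)
    case (insert v V)
    then have "Q (\<lambda>x. v * indicator (A v) x + (\<Sum>v\<in>V. v * indicator (A v) x))"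
      by (intro Qadd Qcmult Qind insert.IH) auto
    then show ?case by (simp only: sum.insert[OF insert.hyps])
  qed (simp add: Q0)
  have Qsimple: "Q s" if s: "simple_function M s" for s
  proof -
    define V where "V = s ` space M"
    have fin: "finite V"
      using s by (simp add: simple_function_def V_def)
    have sV: "s -` {v} \<inter> space M \<in> sets M" if "v \<in> V" for v
      using s that by (auto simp: simple_function_def V_def)
    have *: "s x = (\<Sum>v\<in>V. v * indicator (s -` {v} \<inter> space M) x)" if "x \<in> space M" for x
    proof -
      have "(\<Sum>v\<in>V. v * indicator (s -` {v} \<inter> space M) x) = (\<Sum>v\<in>V. if s x = v then v else 0)"
        using that by (intro sum.cong) (auto simp: indicator_def)
      also have "\<dots> = s x"
        using fin that by (simp add: V_def)
      finally show ?thesis by simp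
    qed
    \<comment> \<open>The expansion of \<open>s\<close> is valid only on \<open>space M\<close>, so
      it is carried through the norm and the membership instead of being used as an equality of
      functions.\<close>
    have n: "L2_norm M (\<lambda>x. g x - s x)
        = L2_norm M (\<lambda>x. g x - (\<Sum>v\<in>V. v * indicator (s -` {v} \<inter> space M) x))" for g
      unfolding L2_norm_def by (intro arg_cong[of _ _ sqrt] Bochner_Integration.integral_cong) (auto simp: *[symmetric])
    have "s \<in> L2_space M \<longleftrightarrow> (\<lambda>x. \<Sum>v\<in>V. v * indicator (s -` {v} \<inter> space M) x) \<in> L2_space M"
      unfolding L2_space_iff
      by (intro conj_cong measurable_cong Bochner_Integration.integrable_cong) (auto simp: *[symmetric])
    then show ?thesis
      using Qsum[of V "\<lambda>v. s -` {v} \<inter> space M", OF fin sV] unfolding Q_def n by auto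
  qed
  have [measurable]: "f \<in> borel_measurable M"
    using f by (simp add: L2_space_iff)
  obtain F where F: "\<And>i. simple_function M (F i)" "\<And>x. x \<in> space M \<Longrightarrow> (\<lambda>i. F i x) \<longlonglongrightarrow> f x"
    "\<And>i x. x \<in> space M \<Longrightarrow> cmod (F i x) \<le> 2 * cmod (f x)"
    using borel_measurable_implies_sequence_metric[of f M 0] \<open>f \<in> borel_measurable M\<close>
    unfolding dist_norm diff_0_right by blast
  have [measurable]: "F i \<in> borel_measurable M" for i
    using F(1) by (rule borel_measurable_simple_function)
  have "(\<lambda>i. \<integral>x. (cmod (F i x - f x))\<^sup>2 \<partial>M) \<longlonglongrightarrow> (\<integral>x. 0 \<partial>M)"
  \<comment> \<open>The approximants satisfy \<open>cmod (F i x) \<le> 2 * cmod (f x)\<close>, so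
    the difference is at most three times \<open>cmod (f x)\<close>; squaring gives the 9.\<close>
  proof (rule integral_dominated_convergence[where w = "\<lambda>x. 9 * (cmod (f x))\<^sup>2"])
    show "integrable M (\<lambda>x. 9 * (cmod (f x))\<^sup>2)"
      using f by (simp add: L2_space_iff)
    show "AE x in M. (\<lambda>i. (cmod (F i x - f x))\<^sup>2) \<longlonglongrightarrow> 0"
    proof (rule AE_I2)
      fix x assume "x \<in> space M"
      then have "(\<lambda>i. (cmod (F i x - f x))\<^sup>2) \<longlonglongrightarrow> (cmod (f x - f x))\<^sup>2"
        by (intro tendsto_intros F(2))
      then show "(\<lambda>i. (cmod (F i x - f x))\<^sup>2) \<longlonglongrightarrow> 0" by simp
    qed
    show "AE x in M. norm ((cmod (F i x - f x))\<^sup>2) \<le> 9 * (cmod (f x))\<^sup>2" for i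
    proof (rule AE_I2)
      fix x assume "x \<in> space M"
      then have "cmod (F i x - f x) \<le> 3 * cmod (f x)"
        using F(3)[of x i] norm_triangle_ineq4[of "F i x" "f x"] by simp
      then have "(cmod (F i x - f x))\<^sup>2 \<le> (3 * cmod (f x))\<^sup>2"
        by (intro power_mono) auto
      then show "norm ((cmod (F i x - f x))\<^sup>2) \<le> 9 * (cmod (f x))\<^sup>2"
        by (simp add: power_mult_distrib)
    qed
  qed auto
  then have "(\<lambda>i. L2_norm M (\<lambda>x. F i x - f x)) \<longlonglongrightarrow> 0"
    unfolding L2_norm_def using tendsto_real_sqrt by fastforce
  then have "\<forall>\<^sub>F i in sequentially. L2_norm M (\<lambda>x. F i x - f x) < e / 2"
    using e by (intro order_tendstoD(2)) auto
  then obtain i where i: "L2_norm M (\<lambda>x. F i x - f x) < e / 2"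
    by (auto simp: eventually_sequentially)
  obtain g where g: "P g" "L2_norm M (\<lambda>x. g x - F i x) < e / 2"
    using Qsimple[OF F(1), of i] e unfolding Q_def by (meson half_gt_zero)
  have "L2_norm M (\<lambda>x. (g x - F i x) + (F i x - f x)) < e"
    using L2_norm_triangle[of "\<lambda>x. g x - F i x" M "\<lambda>x. F i x - f x"] i g Qsimple[OF F(1), of i] f
    by (force intro: L2_space_diff sub simp: Q_def)
  then show ?thesis
    using g(1) by (intro exI[of _ g]) simp
qed

section \<open>Haar measure on a compact abelian group\<close>

text \<open>On probability spaces boundedness gives integrability, which leaves joint measurability
  as the only condition to verify at each use.\<close>

lemma Fubini_bounded:
  fixes f :: "'x \<times> 'y \<Rightarrow> 'z::{banach,second_countable_topology}"
  assumes "prob_space M" "prob_space N" "f \<in> borel_measurable (M \<Otimes>\<^sub>M N)" "\<And>z. norm (f z) \<le> B"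
  shows integral_fst_bounded: "(\<integral>x. (\<integral>y. f (x, y) \<partial>N) \<partial>M) = (\<integral>z. f z \<partial>(M \<Otimes>\<^sub>M N))"
    and integral_swap_bounded:
      "(\<integral>y. (\<integral>x. f (x, y) \<partial>M) \<partial>N) = (\<integral>x. (\<integral>y. f (x, y) \<partial>N) \<partial>M)"
proof -
  interpret pair_prob_space M N
    using assms by (simp add: pair_prob_space_def pair_sigma_finite_def prob_space_imp_sigma_finite)
  have "integrable (M \<Otimes>\<^sub>M N) f"
    using assms by (intro P.integrable_const_bound[of _ B]) auto
  then have i: "integrable (M \<Otimes>\<^sub>M N) (\<lambda>(x, y). f (x, y))"
    by simp
  show "(\<integral>x. (\<integral>y. f (x, y) \<partial>N) \<partial>M) = (\<integral>z. f z \<partial>(M \<Otimes>\<^sub>M N))"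
    using integral_fst[OF i] by simp
  show "(\<integral>y. (\<integral>x. f (x, y) \<partial>M) \<partial>N) = (\<integral>x. (\<integral>y. f (x, y) \<partial>N) \<partial>M)"
    using Fubini_integral[OF i] .
qed

text \<open>Invariance of Haar measure is stated with images of sets, whereas \<open>distr\<close>
  speaks of preimages; on a subgroup, translation by \<open>- a\<close> undoes translation by
  \<open>a\<close>.\<close>

lemma image_add_eq_vimage:
  fixes a :: "'g::ab_group_add"
  assumes "A \<subseteq> K" "\<And>x y. x \<in> K \<Longrightarrow> y \<in> K \<Longrightarrow> x + y \<in> K" "- a \<in> K"
  shows "(+) a -` A \<inter> K = (+) (- a) ` A"
proof (intro equalityI subsetI)
  fix x assume "x \<in> (+) a -` A \<inter> K"
  then show "x \<in> (+) (- a) ` A"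
    by (intro image_eqI[of _ _ "a + x"]) auto
next
  fix x assume "x \<in> (+) (- a) ` A"
  then obtain y where y: "y \<in> A" "x = - a + y" by blast
  then have "- a + y \<in> K"
    using assms by blast
  then show "x \<in> (+) a -` A \<inter> K"
    using y by simp
qed

text \<open>Regularity is left out of the hypotheses so that the lemma also serves the competing
  measure in \<open>haar_unique\<close>.\<close>

lemma distr_translation:
  fixes M :: "'g::{topological_space,ab_group_add} measure"
  assumes sets: "sets M = sets (restrict_space borel K)"
    and inv: "\<And>a A. a \<in> K \<Longrightarrow> A \<in> sets M \<Longrightarrow> emeasure M ((+) a ` A) = emeasure M A"
    and add: "\<And>x y. x \<in> K \<Longrightarrow> y \<in> K \<Longrightarrow> x + y \<in> K"
    and uminus: "\<And>x. x \<in> K \<Longrightarrow> - x \<in> K"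
    and cont: "continuous_on UNIV ((+) a)" and a: "a \<in> K"
  shows "(+) a \<in> measurable M M" "distr M M ((+) a) = M"
proof -
  have sp: "space M = K"
    using sets_eq_imp_space_eq[OF sets] by (simp add: space_restrict_space)
  have "(+) a \<in> measurable (restrict_space borel K) (restrict_space borel K)"
    using add[OF a] by (intro measurable_restrict_space3 borel_measurable_continuous_onI cont) auto
  then show m: "(+) a \<in> measurable M M"
    using measurable_cong_sets[OF sets sets] by blast
  show "distr M M ((+) a) = M"
  proof (rule measure_eqI)
    fix A assume "A \<in> sets (distr M M ((+) a))"
    then have A: "A \<in> sets M" by simp
    then have "A \<subseteq> K" using sets.sets_into_space sp by blast
    have "emeasure (distr M M ((+) a)) A = emeasure M ((+) a -` A \<inter> K)"
      using emeasure_distr[OF m A] sp by simp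
    also have "(+) a -` A \<inter> K = (+) (- a) ` A"
      using \<open>A \<subseteq> K\<close> by (rule image_add_eq_vimage) (use add uminus a in auto)
    also have "emeasure M \<dots> = emeasure M A"
      by (rule inv) (use uminus a A in auto)
    finally show "emeasure (distr M M ((+) a)) A = emeasure M A" .
  qed simp
qed

lemma haar_probability_sets: "haar_probability K M \<Longrightarrow> sets M = sets (restrict_space borel K)"
  by (simp add: haar_probability_def)

lemma haar_probability_space: "haar_probability K M \<Longrightarrow> space M = K"
  using sets_eq_imp_space_eq[OF haar_probability_sets] by (simp add: space_restrict_space)

lemma haar_probability_prob_space: "haar_probability K M \<Longrightarrow> prob_space M"
  by (simp add: haar_probability_def)

lemma haar_probability_continuous_measurable:
  assumes "haar_probability K M" "continuous_on UNIV f"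
  shows "f \<in> borel_measurable M"
  unfolding measurable_cong_sets[OF haar_probability_sets[OF assms(1)] refl]
  by (intro measurable_restrict_space1 borel_measurable_continuous_onI assms)

lemma haar_probability_invariant:
  "haar_probability K M \<Longrightarrow> a \<in> K \<Longrightarrow> A \<in> sets M \<Longrightarrow> emeasure M ((+) a ` A) = emeasure M A"
  unfolding haar_probability_def by blast

lemma haar_probability_outer:
  "haar_probability K M \<Longrightarrow> A \<in> sets M \<Longrightarrow>
    emeasure M A = (INF U\<in>{U. open U \<and> A \<subseteq> U}. emeasure M (U \<inter> K))"
  unfolding haar_probability_def by blast

lemma haar_probability_inner:
  "haar_probability K M \<Longrightarrow> A \<in> sets M \<Longrightarrow>
    emeasure M A = (SUP C\<in>{C. compact C \<and> C \<subseteq> A}. emeasure M C)"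
  unfolding haar_probability_def by blast

definition add_subgroup :: "'g::ab_group_add set \<Rightarrow> bool" where
  "add_subgroup K \<longleftrightarrow> 0 \<in> K \<and> (\<forall>x\<in>K. \<forall>y\<in>K. x + y \<in> K) \<and> (\<forall>x\<in>K. - x \<in> K)"

lemma haar_probability_translation:
  assumes "haar_probability K M" "add_subgroup K" "continuous_on UNIV ((+) a)" "a \<in> K"
  shows "(+) a \<in> measurable M M" "distr M M ((+) a) = M"
  using assms distr_translation[of M K a] by (auto simp: haar_probability_def add_subgroup_def)

text \<open>Invariance gives the same integral for each single \<open>u\<close>; averaging over the
  probability measure \<open>N\<close> and exchanging the integrals brings the average inside. Joint
  measurability of the shifted function is assumed, since measurability of \<open>F\<close> alone
  does not yield it; it is verified later through continuous test functions.\<close>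

lemma haar_average:
  fixes F :: "'g::{topological_space,ab_group_add} \<Rightarrow> complex"
  assumes M: "haar_probability K M" "add_subgroup K" "\<And>a. continuous_on UNIV ((+) (a::'g))"
    and N: "prob_space N" and q: "\<And>u. u \<in> space N \<Longrightarrow> q u \<in> K"
    and F: "F \<in> borel_measurable M" "\<And>x. cmod (F x) \<le> B"
    and meas: "(\<lambda>z. F (q (snd z) + fst z)) \<in> borel_measurable (M \<Otimes>\<^sub>M N)"
  shows "(\<integral>x. F x \<partial>M) = (\<integral>x. (\<integral>u. F (q u + x) \<partial>N) \<partial>M)"
proof -
  interpret N: prob_space N by fact
  have "(\<integral>x. F (q u + x) \<partial>M) = (\<integral>x. F x \<partial>M)" if "u \<in> space N" for u
    using integral_distr[OF haar_probability_translation(1)[OF M q[OF that]] F(1)]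
    by (simp add: haar_probability_translation(2)[OF M q[OF that]])
  then have "(\<integral>x. F x \<partial>M) = (\<integral>u. (\<integral>x. F (q u + x) \<partial>M) \<partial>N)"
    by (simp add: N.prob_space cong: Bochner_Integration.integral_cong)
  also have "\<dots> = (\<integral>x. (\<integral>u. F (q u + x) \<partial>N) \<partial>M)"
    using integral_swap_bounded[OF haar_probability_prob_space[OF M(1)] N meas, where B = B] F(2) by simp
  finally show ?thesis .
qed

text \<open>On a compact group that is not second countable, addition need not be measurable for the
  product \<open>\<sigma>\<close>-algebra. Testing against continuous functions gives a weaker notion of measurability
  that sums do inherit, and Fubini's theorem is only ever applied to such test functions.\<close>

definition baire_measurable :: "'b measure \<Rightarrow> ('b \<Rightarrow> 'a::topological_space) \<Rightarrow> bool" where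
  "baire_measurable N q \<longleftrightarrow>
    (\<forall>g::'a \<Rightarrow> complex. continuous_on UNIV g \<longrightarrow> (\<lambda>y. g (q y)) \<in> borel_measurable N)"

lemma baire_measurableD:
  "baire_measurable N q \<Longrightarrow> continuous_on UNIV (g :: _ \<Rightarrow> complex) \<Longrightarrow> (\<lambda>y. g (q y)) \<in> borel_measurable N"
  by (simp add: baire_measurable_def)

lemma borel_measurable_imp_baire_measurable:
  "q \<in> borel_measurable N \<Longrightarrow> baire_measurable N q"
  by (auto simp: baire_measurable_def intro: measurable_compose borel_measurable_continuous_onI)

section \<open>Continuous functions on a compact group and measurability of sums\<close>

locale compact_haar =
  fixes \<mu> :: "'a::{topological_ab_group_add,t2_space} measure"
  assumes compact_UNIV: "compact (UNIV :: 'a set)"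
    and haar: "haar_probability UNIV \<mu>"
begin

sublocale prob_space \<mu>
  using haar by (rule haar_probability_prob_space)

lemma sets_haar [measurable_cong]: "sets \<mu> = sets borel"
  using haar_probability_sets[OF haar] by simp

lemma space_haar [simp]: "space \<mu> = UNIV"
  using haar_probability_space[OF haar] .

lemma measurable_haar_iff: "f \<in> borel_measurable \<mu> \<longleftrightarrow> f \<in> borel_measurable borel"
  by (simp add: measurable_cong_sets[OF sets_haar refl])

lemma continuous_measurable: "continuous_on UNIV f \<Longrightarrow> f \<in> borel_measurable \<mu>"
  using haar by (rule haar_probability_continuous_measurable)

lemma continuous_bounded:
  fixes g :: "'a \<Rightarrow> complex"
  assumes "continuous_on UNIV g"
  obtains B where "\<And>x. cmod (g x) \<le> B"
proof -
  have "bounded (range g)"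
    using assms compact_UNIV by (intro compact_imp_bounded compact_continuous_image)
  then show ?thesis
    using that by (auto simp: bounded_iff)
qed

lemma continuous_L2: "continuous_on UNIV g \<Longrightarrow> g \<in> L2_space \<mu>"
  by (metis L2_space_bounded continuous_bounded continuous_measurable)

lemma continuous_on_add_left: "continuous_on UNIV ((+) (a::'a))"
  by (intro continuous_intros)

lemma distr_add: "distr \<mu> \<mu> ((+) a) = \<mu>"
  using haar_probability_translation(2)[OF haar _ continuous_on_add_left] by (simp add: add_subgroup_def)

lemma integral_add:
  fixes F :: "'a \<Rightarrow> 'b::{banach,second_countable_topology}"
  assumes "F \<in> borel_measurable \<mu>"
  shows "(\<integral>x. F (a + x) \<partial>\<mu>) = (\<integral>x. F x \<partial>\<mu>)"
proof -
  have "(+) a \<in> measurable \<mu> \<mu>"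
    using continuous_measurable[OF continuous_on_add_left] by (simp add: measurable_cong_sets[OF refl sets_haar])
  from integral_distr[OF this assms] show ?thesis
    by (simp add: distr_add)
qed

text \<open>The tube lemma makes the neighbourhood independent of \<open>v\<close>: this is uniform
  continuity on a compact group, without a metric.\<close>

lemma uniformly_close_neighbourhood:
  fixes g :: "'a \<Rightarrow> complex"
  assumes g: "continuous_on UNIV g" and e: "0 < e"
  obtains U where "open U" "x \<in> U" "\<And>x' v. x' \<in> U \<Longrightarrow> dist (g (x' + v)) (g (x + v)) < e"
proof -
  let ?W = "{z. dist (g (fst z + snd z)) (g (x + snd z)) < e}"
  have "open ?W"
    by (intro open_Collect_less continuous_intros continuous_on_compose2[OF g]) auto
  moreover have "{x} \<times> UNIV \<subseteq> ?W"
    using e by auto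
  ultimately obtain U where U: "x \<in> U" "open U" "U \<times> UNIV \<subseteq> ?W"
    using Elementary_Topology.tube_lemma[OF compact_UNIV, of ?W x] by blast
  have "dist (g (x' + v)) (g (x + v)) < e" if "x' \<in> U" for x' v
    using subsetD[OF U(3), of "(x', v)"] that by simp
  then show ?thesis
    using U that by blast
qed

text \<open>This discretizes the first summand: on each of finitely many open pieces,
  \<open>g (x + v)\<close> is within \<open>e\<close> of a function of \<open>v\<close>
  alone.\<close>

lemma finite_uniform_cover:
  fixes g :: "'a \<Rightarrow> complex"
  assumes g: "continuous_on UNIV g" and e: "0 < e"
  obtains C U where "finite C" "\<And>c. open (U c)" "(\<Union>c\<in>C. U c) = UNIV"
    "\<And>c x v. c \<in> C \<Longrightarrow> x \<in> U c \<Longrightarrow> dist (g (x + v)) (g (c + v)) < e"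
proof -
  have "\<forall>c. \<exists>U. open U \<and> c \<in> U \<and> (\<forall>x\<in>U. \<forall>v. dist (g (x + v)) (g (c + v)) < e)"
  proof
    fix c
    obtain U where "open U" "c \<in> U" "\<And>x v. x \<in> U \<Longrightarrow> dist (g (x + v)) (g (c + v)) < e"
      by (rule uniformly_close_neighbourhood[OF assms, of c], rule that)
    then show "\<exists>U. open U \<and> c \<in> U \<and> (\<forall>x\<in>U. \<forall>v. dist (g (x + v)) (g (c + v)) < e)"
      by blast
  qed
  from choice[OF this] obtain U
    where R: "\<forall>c. open (U c) \<and> c \<in> U c \<and> (\<forall>x\<in>U c. \<forall>v. dist (g (x + v)) (g (c + v)) < e)" ..
  then have U: "open (U c)" "c \<in> U c" for c
    by simp_all
  have close: "dist (g (x + v)) (g (c + v)) < e" if "x \<in> U c" for c x v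
    using R that by simp
  have "UNIV \<subseteq> (\<Union>c\<in>UNIV. U c)"
    using U(2) by blast
  then obtain C where C: "finite C" "UNIV \<subseteq> (\<Union>c\<in>C. U c)"
    using compactE_image[OF compact_UNIV, of UNIV U, OF U(1)] by metis
  show ?thesis
  proof (rule that[of C U])
    show "(\<Union>c\<in>C. U c) = UNIV"
      using C(2) by (rule top.extremum_uniqueI)
  qed (use C(1) U(1) close in auto)
qed

text \<open>The hypotheses are asymmetric because \<open>p\<close> is seen through preimages of the
  open pieces of a cover, while \<open>q\<close> is seen only through the continuous functions
  \<open>v \<mapsto> g (c + v)\<close>. The conclusion has the form required of the second summand,
  so longer sums are treated by nesting.\<close>

lemma baire_measurable_add:
  fixes p :: "'b \<Rightarrow> 'a" and q :: "'c \<Rightarrow> 'a"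
  assumes p: "p \<in> borel_measurable M" and q: "baire_measurable N q"
  shows "baire_measurable (M \<Otimes>\<^sub>M N) (\<lambda>z. p (fst z) + q (snd z))"
  unfolding baire_measurable_def
proof (intro allI impI borel_measurableI)
  fix g :: "'a \<Rightarrow> complex" and S :: "complex set"
  assume g: "continuous_on UNIV g" and S: "open S"
  let ?f = "\<lambda>z. g (p (fst z) + q (snd z))"
  define e where "e n = 1 / real (Suc n)" for n
  have e: "0 < e n" for n by (simp add: e_def)
  define R where "R n C U \<longleftrightarrow> finite C \<and> (\<forall>c. open (U c)) \<and> (\<Union>c\<in>C. U c) = UNIV \<and>
      (\<forall>c\<in>C. \<forall>x\<in>U c. \<forall>v. dist (g (x + v)) (g (c + v)) < e n)" for n C U
  have "\<exists>C U. R n C U" for n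
  proof -
    obtain C U where "finite C" "\<And>c. open (U c)" "(\<Union>c\<in>C. U c) = UNIV"
      "\<And>c x v. c \<in> C \<Longrightarrow> x \<in> U c \<Longrightarrow> dist (g (x + v)) (g (c + v)) < e n"
      by (rule finite_uniform_cover[OF g e[of n]], rule that)
    then have "R n C U"
      unfolding R_def by blast
    then show ?thesis by blast
  qed
  then obtain C U where R: "\<And>n. R n (C n) (U n)"
    by metis
  have C: "finite (C n)" and U: "open (U n c)" and cover: "(\<Union>c\<in>C n. U n c) = UNIV" for n c
    using R[of n] by (simp_all add: R_def)
  have close: "dist (g (x + v)) (g (c + v)) < e n" if "c \<in> C n" "x \<in> U n c" for n c x v
    using R[of n] that by (simp add: R_def)
  \<comment> \<open>\<open>T n\<close> is \<open>S\<close> shrunk by \<open>e n\<close>: if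
    \<open>g (c + q y)\<close> lies in it, then every value within \<open>e n\<close> lies in
    \<open>S\<close>. With a countable union over \<open>n\<close> and a finite one over
    \<open>C n\<close>, the preimage becomes a union of measurable rectangles.\<close>
  define T where "T n = {w. ball w (e n) \<subseteq> S}" for n
  have T: "closed (T n)" for n
  proof -
    have "- T n = (\<Union>v\<in>-S. ball v (e n))"
    proof (intro equalityI subsetI)
      fix w assume "w \<in> - T n"
      then obtain v where "dist w v < e n" "v \<notin> S"
        unfolding T_def subset_iff mem_ball by blast
      then show "w \<in> (\<Union>v\<in>-S. ball v (e n))"
        by (intro UN_I[of v]) (simp_all add: dist_commute)
    next
      fix w assume "w \<in> (\<Union>v\<in>-S. ball v (e n))"
      then obtain v where "dist w v < e n" "v \<notin> S"
        by (auto simp: dist_commute)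
      then show "w \<in> - T n"
        unfolding T_def by (auto simp: subset_iff)
    qed
    then show ?thesis
      by (simp add: closed_def open_UN)
  qed
  have "?f -` S \<inter> space (M \<Otimes>\<^sub>M N) =
      (\<Union>n. \<Union>c\<in>C n. (p -` U n c \<inter> space M) \<times> ((\<lambda>y. g (c + q y)) -` T n \<inter> space N))"
  proof (intro equalityI subsetI)
    fix z assume z: "z \<in> ?f -` S \<inter> space (M \<Otimes>\<^sub>M N)"
    then obtain r where r: "0 < r" "ball (?f z) r \<subseteq> S"
      using S by (auto simp: open_contains_ball)
    \<comment> \<open>Half of \<open>r\<close> pays for replacing \<open>p (fst z)\<close> by the
      centre \<open>c\<close>, the other half for the ball in the definition of
      \<open>T n\<close>.\<close>
    obtain n where n: "e n < r / 2"
      unfolding e_def using nat_approx_posE[of "r / 2"] r(1) by auto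
    have "p (fst z) \<in> (\<Union>c\<in>C n. U n c)"
      by (simp add: cover)
    then obtain c where c: "c \<in> C n" "p (fst z) \<in> U n c"
      by auto
    have d: "dist (?f z) (g (c + q (snd z))) < e n"
      using close[OF c] .
    have "ball (g (c + q (snd z))) (e n) \<subseteq> ball (?f z) r"
    proof
      fix w assume "w \<in> ball (g (c + q (snd z))) (e n)"
      then show "w \<in> ball (?f z) r"
        using d n dist_triangle[of "?f z" w "g (c + q (snd z))"] by simp
    qed
    then have "g (c + q (snd z)) \<in> T n"
      using r(2) by (auto simp: T_def)
    then show "z \<in> (\<Union>n. \<Union>c\<in>C n. (p -` U n c \<inter> space M) \<times> ((\<lambda>y. g (c + q y)) -` T n \<inter> space N))"
      using c z by (cases z) (auto simp: space_pair_measure)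
  next
    fix z assume "z \<in> (\<Union>n. \<Union>c\<in>C n. (p -` U n c \<inter> space M) \<times> ((\<lambda>y. g (c + q y)) -` T n \<inter> space N))"
    then obtain n c where z: "z \<in> space M \<times> space N" "c \<in> C n" "p (fst z) \<in> U n c"
      "g (c + q (snd z)) \<in> T n"
      by auto
    have "?f z \<in> ball (g (c + q (snd z))) (e n)"
      using close[OF z(2,3)] by (simp add: dist_commute)
    then show "z \<in> ?f -` S \<inter> space (M \<Otimes>\<^sub>M N)"
      using z by (auto simp: T_def space_pair_measure)
  qed
  also have "\<dots> \<in> sets (M \<Otimes>\<^sub>M N)"
  proof (intro sets.countable_UN sets.finite_UN C pair_measureI image_subsetI)
    fix n c
    show "p -` U n c \<inter> space M \<in> sets M"
      using p U by (intro measurable_sets[OF p]) auto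
    have "(\<lambda>y. g (c + q y)) \<in> borel_measurable N"
      by (rule baire_measurableD[OF q, of "\<lambda>v. g (c + v)"])
        (intro continuous_intros continuous_on_compose2[OF g], auto)
    then show "(\<lambda>y. g (c + q y)) -` T n \<inter> space N \<in> sets N"
      using T by (intro measurable_sets) auto
  qed
  finally show "?f -` S \<inter> space (M \<Otimes>\<^sub>M N) \<in> sets (M \<Otimes>\<^sub>M N)" .
qed

section \<open>Separation by continuous functions and uniqueness of Haar measure\<close>

lemma Urysohn_function:
  fixes S U :: "'a set"
  assumes "closed S" "open U" "S \<subseteq> U"
  obtains h :: "'a \<Rightarrow> real" where "continuous_on UNIV h" "\<And>x. 0 \<le> h x" "\<And>x. h x \<le> 1"
    "\<And>x. x \<in> S \<Longrightarrow> h x = 1" "\<And>x. x \<notin> U \<Longrightarrow> h x = 0"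
proof -
  have "Hausdorff_space (euclidean :: 'a topology)"
    unfolding Hausdorff_space_def disjnt_def using hausdorff by fastforce
  then have "normal_space (euclidean :: 'a topology)"
    using compact_UNIV
    by (intro compact_Hausdorff_or_regular_imp_normal_space) (simp_all add: compact_space_def)
  then obtain f :: "'a \<Rightarrow> real" where f: "continuous_map euclidean (top_of_set {0..1}) f"
    "f ` (- U) \<subseteq> {0}" "f ` S \<subseteq> {1}"
    using Urysohn_lemma[of "euclidean :: 'a topology" "- U" S 0 1] assms
    by (metis closed_closedin closed_Compl disjnt_def Int_commute Diff_eq Diff_eq_empty_iff zero_le_one)
  then have "continuous_on UNIV f" "\<And>x. f x \<in> {0..1}"
    by (auto simp: continuous_map_in_subtopology)
  then show ?thesis
    using f by (intro that[of f]) auto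
qed

text \<open>For continuous \<open>h\<close> the double integral of \<open>h (x + y)\<close> against
  \<open>M\<close> and \<open>\<mu>\<close> equals the integral of \<open>h\<close> against either
  measure, depending on which variable is integrated first. Urysohn functions then compare compact
  with open sets. From \<open>M\<close> only inner regularity is asked, a property that passes
  easily to pushforwards.\<close>

lemma haar_unique:
  fixes M :: "'a measure"
  assumes M: "prob_space M" and sets: "sets M = sets borel"
    and inv: "\<And>a A. A \<in> sets borel \<Longrightarrow> emeasure M ((+) a ` A) = emeasure M A"
    and tight: "\<And>A. A \<in> sets borel \<Longrightarrow> emeasure M A = (SUP C\<in>{C. compact C \<and> C \<subseteq> A}. emeasure M C)"
  shows "M = \<mu>"
proof -
  interpret M: prob_space M by fact
  have sp: "space M = UNIV"
    using sets_eq_imp_space_eq[OF sets] by simp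
  have mM: "f \<in> borel_measurable M \<longleftrightarrow> f \<in> borel_measurable borel" for f :: "'a \<Rightarrow> complex"
    by (simp add: measurable_cong_sets[OF sets refl])
  have eq: "(\<integral>x. h x \<partial>M) = (\<integral>x. h x \<partial>\<mu>)" if h: "continuous_on UNIV h" for h :: "'a \<Rightarrow> complex"
  proof -
    obtain B where B: "\<And>x. cmod (h x) \<le> B"
      using continuous_bounded[OF h] by blast
    have hm: "h \<in> borel_measurable M"
      using h by (simp add: mM borel_measurable_continuous_onI)
    have meas: "(\<lambda>z. h (fst z + snd z)) \<in> borel_measurable (M \<Otimes>\<^sub>M \<mu>)"
      by (intro baire_measurableD[OF baire_measurable_add h] borel_measurable_imp_baire_measurable)
        (simp_all add: measurable_ident_sets sets sets_haar)
    have tr: "(\<integral>x. h (x + y) \<partial>M) = (\<integral>x. h x \<partial>M)" for y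
    proof -
      note * = distr_translation[of M UNIV y, simplified, OF sets inv continuous_on_add_left,
          unfolded sets, simplified]
      show ?thesis
        using integral_distr[OF *(1) hm] *(2) by (simp add: add.commute)
    qed
    have "(\<integral>x. h x \<partial>M) = (\<integral>y. (\<integral>x. h (x + y) \<partial>M) \<partial>\<mu>)"
      using prob_space by (simp add: tr)
    also have "\<dots> = (\<integral>x. (\<integral>y. h (x + y) \<partial>\<mu>) \<partial>M)"
      using integral_swap_bounded[OF M prob_space_axioms meas, where B = B] B by simp
    also have "\<dots> = (\<integral>x. h x \<partial>\<mu>)"
      by (simp add: integral_add continuous_measurable[OF h] M.prob_space)
    finally show ?thesis .
  qed
  have le1: "measure M C \<le> measure \<mu> U" if C: "compact C" and U: "open U" "C \<subseteq> U" for C U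
  proof -
    obtain h where h: "continuous_on UNIV h" "\<And>x. 0 \<le> h x" "\<And>x. h x \<le> 1"
      "\<And>x. x \<in> C \<Longrightarrow> h x = (1::real)" "\<And>x. x \<notin> U \<Longrightarrow> h x = 0"
      using Urysohn_function[OF compact_imp_closed[OF C] U] by blast
    have cl: "closed C" using C by (rule compact_imp_closed)
    have hb: "h \<in> borel_measurable borel"
      using h(1) by (rule borel_measurable_continuous_onI)
    have iM: "integrable M h"
      by (rule M.integrable_const_bound[of _ 1])
        (use h hb in \<open>auto simp: measurable_cong_sets[OF sets refl]\<close>)
    have i\<mu>: "integrable \<mu> h"
      by (rule integrable_const_bound[of _ 1])
        (use h hb in \<open>auto simp: measurable_cong_sets[OF sets_haar refl]\<close>)
    have "complex_of_real (\<integral>x. h x \<partial>M) = (\<integral>x. complex_of_real (h x) \<partial>M)"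
      by simp
    also have "\<dots> = (\<integral>x. complex_of_real (h x) \<partial>\<mu>)"
      by (rule eq) (intro continuous_intros h)
    also have "\<dots> = complex_of_real (\<integral>x. h x \<partial>\<mu>)"
      by simp
    finally have hh: "(\<integral>x. h x \<partial>M) = (\<integral>x. h x \<partial>\<mu>)"
      by (simp only: of_real_eq_iff)
    have "measure M C = (\<integral>x. indicator C x \<partial>M)"
      using cl sp by simp
    also have "\<dots> \<le> (\<integral>x. h x \<partial>M)"
    proof (rule integral_mono[OF _ iM])
      show "integrable M (indicator C :: _ \<Rightarrow> real)"
        using cl sets by (intro integrable_real_indicator) (auto simp: less_top[symmetric])
    qed (use h in \<open>auto simp: indicator_def\<close>)
    also have "\<dots> \<le> (\<integral>x. indicator U x \<partial>\<mu>)"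
      unfolding hh
    proof (rule integral_mono[OF i\<mu>])
      show "integrable \<mu> (indicator U :: _ \<Rightarrow> real)"
        using U(1) by (intro integrable_real_indicator) (auto simp: less_top[symmetric] sets_haar)
    qed (use h in \<open>auto simp: indicator_def\<close>)
    also have "\<dots> = measure \<mu> U"
      by simp
    finally show ?thesis .
  qed
  \<comment> \<open>Inner regularity of \<open>M\<close> meets outer regularity of
    \<open>\<mu>\<close>: every compact set inside \<open>A\<close> is compared with every open set
    around \<open>A\<close>.\<close>
  have le: "emeasure M A \<le> emeasure \<mu> A" if A: "A \<in> sets borel" for A
  proof -
    have "emeasure \<mu> A = (INF U\<in>{U. open U \<and> A \<subseteq> U}. emeasure \<mu> (U \<inter> UNIV))"
      using A by (intro haar_probability_outer[OF haar]) (simp add: sets_haar)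
    also have "emeasure M A \<le> \<dots>"
      unfolding tight[OF A]
    proof (intro SUP_least INF_greatest)
      fix C U assume "C \<in> {C. compact C \<and> C \<subseteq> A}" "U \<in> {U. open U \<and> A \<subseteq> U}"
      then have "measure M C \<le> measure \<mu> U"
        by (intro le1) auto
      then show "emeasure M C \<le> emeasure \<mu> (U \<inter> UNIV)"
        by (simp add: M.emeasure_eq_measure emeasure_eq_measure)
    qed
    finally show ?thesis .
  qed
  show "M = \<mu>"
  proof (rule measure_eqI)
    show "sets M = sets \<mu>"
      by (simp add: sets sets_haar)
    fix A assume "A \<in> sets M"
    then have A: "A \<in> sets borel" by (simp add: sets)
    then have cA: "- A \<in> sets borel" by simp
    \<comment> \<open>Both total masses are 1, so the inequality for the complement reverses the one
      for \<open>A\<close>.\<close>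
    have "measure M (- A) = 1 - measure M A" "measure \<mu> (- A) = 1 - measure \<mu> A"
      using M.prob_compl[of A] prob_compl[of A] A by (simp_all add: sets sets_haar sp Compl_eq_Diff_UNIV)
    then have "measure M A = measure \<mu> A"
      using le[OF A] le[OF cA] by (simp add: M.emeasure_eq_measure emeasure_eq_measure)
    then show "emeasure M A = emeasure \<mu> A"
      by (simp add: M.emeasure_eq_measure emeasure_eq_measure)
  qed
qed

text \<open>By uniqueness it suffices to check invariance and inner regularity. Surjectivity lifts a
  translation by \<open>a\<close> to one by some \<open>k\<close> in \<open>K\<close>, and
  continuity sends compact subsets of the preimage to compact subsets of \<open>A\<close>.
  Coordinates on the kernel, dilations, and sums and differences of coordinates are all
  instances.\<close>

lemma haar_pushforward:
  fixes M :: "'g::{topological_space,ab_group_add} measure" and p :: "'g \<Rightarrow> 'a"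
  assumes M: "haar_probability K M" "add_subgroup K"
    and p: "continuous_on UNIV p" "\<And>x y. p (x + y) = p x + p y" "p ` K = UNIV"
  shows "distr M borel p = \<mu>"
proof (rule haar_unique)
  have sp: "space M = K" using M by (intro haar_probability_space)
  have m: "p \<in> borel_measurable M"
    using M(1) p(1) by (rule haar_probability_continuous_measurable)
  interpret M: prob_space M using M by (intro haar_probability_prob_space)
  show "prob_space (distr M borel p)"
    using m by (rule M.prob_space_distr)
  show "sets (distr M borel p) = sets borel"
    by simp
  have em: "emeasure (distr M borel p) A = emeasure M (p -` A \<inter> K)" if "A \<in> sets borel" for A
    using emeasure_distr[OF m that] sp by simp
  have pm: "p -` A \<inter> K \<in> sets M" if "A \<in> sets borel" for A
    using measurable_sets[OF m that] sp by simp
  fix A :: "'a set" assume A: "A \<in> sets borel"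
  show "emeasure (distr M borel p) ((+) a ` A) = emeasure (distr M borel p) A" for a
  proof -
    obtain k where k: "k \<in> K" "p k = a"
      using p(3) by (metis UNIV_I imageE)
    have pd: "p (x - k) = p x - a" for x
      using p(2)[of k "x - k"] k by (simp add: algebra_simps)
    have kd: "x - k \<in> K" if "x \<in> K" for x
      using M(2) k(1) that unfolding add_subgroup_def by (metis diff_conv_add_uminus)
    have "(+) a ` A = (+) (- a) -` A \<inter> UNIV"
      using image_add_eq_vimage[of A UNIV "- a"] by simp
    moreover have "(+) (- a) -` A \<in> sets borel"
      using A by (intro measurable_sets_borel[OF borel_measurable_continuous_onI[OF continuous_on_add_left]])
    ultimately have aA: "(+) a ` A \<in> sets borel"
      by simp
    have "p -` ((+) a ` A) \<inter> K = (+) k ` (p -` A \<inter> K)"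
    proof (intro equalityI subsetI)
      fix x assume x: "x \<in> p -` ((+) a ` A) \<inter> K"
      then have "x - k \<in> p -` A \<inter> K"
        using kd by (auto simp: pd)
      then show "x \<in> (+) k ` (p -` A \<inter> K)"
        by (intro image_eqI[of _ _ "x - k"]) auto
    next
      fix x assume "x \<in> (+) k ` (p -` A \<inter> K)"
      then show "x \<in> p -` ((+) a ` A) \<inter> K"
        using M(2) k by (auto simp: p(2) add_subgroup_def)
    qed
    then show ?thesis
      using haar_probability_invariant[OF M(1) k(1) pm[OF A]] by (simp add: em[OF A] em[OF aA])
  qed
  show "emeasure (distr M borel p) A
      = (SUP C\<in>{C. compact C \<and> C \<subseteq> A}. emeasure (distr M borel p) C)"
  proof (rule antisym)
    have "emeasure M (p -` A \<inter> K) = (SUP C\<in>{C. compact C \<and> C \<subseteq> p -` A \<inter> K}. emeasure M C)"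
      using M(1) pm[OF A] by (rule haar_probability_inner)
    also have "\<dots> \<le> (SUP C\<in>{C. compact C \<and> C \<subseteq> A}. emeasure (distr M borel p) C)"
    proof (rule SUP_mono)
      fix C assume C: "C \<in> {C. compact C \<and> C \<subseteq> p -` A \<inter> K}"
      then have c: "compact (p ` C)"
        using p(1) by (intro compact_continuous_image) (auto intro: continuous_on_subset)
      then have b: "p ` C \<in> sets borel"
        by (intro borel_closed compact_imp_closed)
      have "emeasure M C \<le> emeasure M (p -` (p ` C) \<inter> K)"
        using C by (intro emeasure_mono pm[OF b]) auto
      then show "\<exists>D\<in>{C. compact C \<and> C \<subseteq> A}. emeasure M C \<le> emeasure (distr M borel p) D"
        using c C by (intro bexI[of _ "p ` C"]) (auto simp: em[OF b])
    qed
    finally show "emeasure (distr M borel p) A \<le> (SUP C\<in>{C. compact C \<and> C \<subseteq> A}. emeasure (distr M borel p) C)"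
      by (simp add: em[OF A])
  qed (use A in \<open>auto intro!: SUP_least emeasure_mono\<close>)
qed

section \<open>Transfer along pushforwards and density of continuous functions\<close>

lemma integral_pushforward:
  fixes F :: "'a \<Rightarrow> 'b::{banach,second_countable_topology}"
  assumes "distr M borel p = \<mu>" "p \<in> borel_measurable M" "F \<in> borel_measurable \<mu>"
  shows "(\<integral>x. F (p x) \<partial>M) = (\<integral>x. F x \<partial>\<mu>)"
  using integral_distr[OF assms(2), of F] assms by (simp add: measurable_haar_iff)

lemma L2_pushforward:
  assumes "distr M borel p = \<mu>" "p \<in> borel_measurable M" "f \<in> L2_space \<mu>"
  shows "(\<lambda>x. f (p x)) \<in> L2_space M" "L2_norm M (\<lambda>x. f (p x)) = L2_norm \<mu> f"
proof -
  have m: "f \<in> borel_measurable borel"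
    using assms(3) by (simp add: L2_space_iff measurable_haar_iff)
  have "integrable (distr M borel p) (\<lambda>x. (cmod (f x))\<^sup>2)"
    using assms by (simp add: L2_space_iff)
  then have "integrable M (\<lambda>x. (cmod (f (p x)))\<^sup>2)"
    using assms(2) m by (subst (asm) integrable_distr_eq) auto
  then show "(\<lambda>x. f (p x)) \<in> L2_space M"
    using measurable_compose[OF assms(2) m] by (simp add: L2_space_iff)
  have "(\<lambda>x. (cmod (f x))\<^sup>2) \<in> borel_measurable \<mu>"
    using m by (simp add: measurable_haar_iff)
  from integral_pushforward[OF assms(1,2) this]
  show "L2_norm M (\<lambda>x. f (p x)) = L2_norm \<mu> f"
    by (simp add: L2_norm_def)
qed

text \<open>Only indicators need approximation. Regularity encloses \<open>A\<close> between a
  compact \<open>C\<close> and an open \<open>U\<close> of nearly equal measure, and a Urysohn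
  function for this pair differs from the indicator by at most 1, and only on
  \<open>U - C\<close>.\<close>

lemma continuous_dense_L2:
  assumes f: "f \<in> L2_space \<mu>" and e: "0 < e"
  shows "\<exists>g. continuous_on UNIV g \<and> L2_norm \<mu> (\<lambda>x. g x - f x) < e"
proof (rule L2_dense_induct[OF f _ _ _ _ _ e])
  show "g \<in> L2_space \<mu>" if "continuous_on UNIV g" for g
    using that by (rule continuous_L2)
next
  fix A :: "'a set" and e :: real assume A: "A \<in> sets \<mu>" and e: "0 < e"
  \<comment> \<open>The squared L^2 error is at most the measure of \<open>U - C\<close>, to which
    the outer and the inner approximation each contribute less than \<open>d\<close>.\<close>
  define d where "d = e\<^sup>2 / 2"
  have d: "0 < d" using e by (simp add: d_def)
  have "\<exists>U. open U \<and> A \<subseteq> U \<and> measure \<mu> U < measure \<mu> A + d"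
  proof -
    have "emeasure \<mu> A < ennreal (measure \<mu> A + d)"
      using d by (simp add: emeasure_eq_measure ennreal_less_iff)
    then obtain U where "open U" "A \<subseteq> U" "emeasure \<mu> (U \<inter> UNIV) < ennreal (measure \<mu> A + d)"
      unfolding haar_probability_outer[OF haar A] INF_less_iff by blast
    then show ?thesis
      by (intro exI[of _ U]) (simp add: emeasure_eq_measure ennreal_less_iff)
  qed
  then obtain U where U: "open U" "A \<subseteq> U" "measure \<mu> U < measure \<mu> A + d" by blast
  have "\<exists>C. compact C \<and> C \<subseteq> A \<and> measure \<mu> A - d < measure \<mu> C"
  \<comment> \<open>A negative number is truncated to 0 by \<open>ennreal\<close>, and the strict
    inequality could then fail for a null set; the empty set serves in that case.\<close>
  proof (cases "measure \<mu> A - d < 0")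
    case True
    then show ?thesis by (intro exI[of _ "{}"]) auto
  next
    case False
    then have "ennreal (measure \<mu> A - d) < emeasure \<mu> A"
      using d by (simp add: emeasure_eq_measure ennreal_less_iff)
    then obtain C where "compact C" "C \<subseteq> A" "ennreal (measure \<mu> A - d) < emeasure \<mu> C"
      unfolding haar_probability_inner[OF haar A] less_SUP_iff by blast
    then show ?thesis
      using False by (intro exI[of _ C]) (simp add: emeasure_eq_measure ennreal_less_iff)
  qed
  then obtain C where C: "compact C" "C \<subseteq> A" "measure \<mu> A - d < measure \<mu> C" by blast
  have cl: "closed C" using C(1) by (rule compact_imp_closed)
  obtain h where h: "continuous_on UNIV h" "\<And>x. 0 \<le> h x" "\<And>x. h x \<le> 1"
    "\<And>x. x \<in> C \<Longrightarrow> h x = (1::real)" "\<And>x. x \<notin> U \<Longrightarrow> h x = 0"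
    using Urysohn_function[OF cl U(1)] C(2) U(2) by blast
  have le: "(cmod (complex_of_real (h x) - indicator A x))\<^sup>2 \<le> indicator (U - C) x" for x
  proof -
    have "cmod (complex_of_real (h x) - indicator A x) = \<bar>h x - indicator A x\<bar>"
      by (metis norm_of_real of_real_diff of_real_indicator)
    moreover have "\<bar>h x - indicator A x\<bar> \<le> indicator (U - C) x"
      using h(2-5)[of x] C(2) U(2) by (auto simp: indicator_def)
    ultimately have "(cmod (complex_of_real (h x) - indicator A x))\<^sup>2 \<le> (indicator (U - C) x)\<^sup>2"
      by (intro power_mono) auto
    also have "\<dots> = indicator (U - C) x"
      by (simp add: indicator_def)
    finally show ?thesis .
  qed
  have "(L2_norm \<mu> (\<lambda>x. complex_of_real (h x) - indicator A x))\<^sup>2 \<le> (\<integral>x. indicator (U - C) x \<partial>\<mu>)"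
    unfolding L2_norm_power2
  proof (rule integral_mono)
    have "(\<lambda>x. complex_of_real (h x)) \<in> L2_space \<mu>"
      by (intro continuous_L2 continuous_intros h)
    moreover have "indicator A \<in> L2_space \<mu>"
      using A by (intro L2_space_bounded[of _ 1]) (auto simp: indicator_def)
    ultimately show "integrable \<mu> (\<lambda>x. (cmod (complex_of_real (h x) - indicator A x))\<^sup>2)"
      using L2_space_diff unfolding L2_space_iff by blast
    show "integrable \<mu> (indicator (U - C) :: _ \<Rightarrow> real)"
      using U(1) cl by (auto simp: sets_haar less_top[symmetric])
  qed (rule le)
  also have "\<dots> = measure \<mu> U - measure \<mu> C"
    using U C cl by (simp add: finite_measure_Diff sets_haar)
  also have "\<dots> < e\<^sup>2"
    using U(3) C(3) by (simp add: d_def)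
  finally have "L2_norm \<mu> (\<lambda>x. complex_of_real (h x) - indicator A x) < e"
    using e by (intro power2_less_imp_less[of _ e]) auto
  then show "\<exists>g. continuous_on UNIV g \<and> L2_norm \<mu> (\<lambda>x. g x - indicator A x) < e"
    using h(1) by (intro exI[of _ "\<lambda>x. complex_of_real (h x)"]) (auto intro: continuous_intros)
qed (auto intro: continuous_intros)

text \<open>A subsequence provides convergence almost everywhere in addition to convergence in norm;
  Fatou's lemma will need the former, continuity of the norms the latter.\<close>

lemma continuous_approx_seq:
  assumes f: "f \<in> L2_space \<mu>"
  obtains F where "\<And>n. continuous_on UNIV (F n)"
    "(\<lambda>n. L2_norm \<mu> (\<lambda>x. F n x - f x)) \<longlonglongrightarrow> 0"
    "AE x in \<mu>. (\<lambda>n. F n x) \<longlonglongrightarrow> f x"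
proof -
  have "\<exists>g. continuous_on UNIV g \<and> L2_norm \<mu> (\<lambda>x. g x - f x) < 1 / real (Suc n)" for n
    by (intro continuous_dense_L2 f) simp
  then obtain G where G: "\<And>n. continuous_on UNIV (G n)"
    "\<And>n. L2_norm \<mu> (\<lambda>x. G n x - f x) < 1 / real (Suc n)"
    by metis
  have lim: "(\<lambda>n. L2_norm \<mu> (\<lambda>x. G n x - f x)) \<longlonglongrightarrow> 0"
    by (rule Lim_null_comparison[OF always_eventually LIMSEQ_inverse_real_of_nat])
      (use G(2) in \<open>auto simp: L2_norm_nonneg inverse_eq_divide intro: less_imp_le\<close>)
  have d: "(\<lambda>x. G n x - f x) \<in> L2_space \<mu>" for n
    by (rule L2_space_diff[OF continuous_L2[OF G(1)] f])
  have "(\<lambda>n. (L2_norm \<mu> (\<lambda>x. G n x - f x))\<^sup>2) \<longlonglongrightarrow> 0\<^sup>2"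
    by (intro tendsto_intros lim)
  then have "(\<lambda>n. \<integral>x. norm ((cmod (G n x - f x))\<^sup>2) \<partial>\<mu>) \<longlonglongrightarrow> 0"
    by (simp add: L2_norm_power2)
  moreover have "integrable \<mu> (\<lambda>x. (cmod (G n x - f x))\<^sup>2)" for n
    using d by (simp add: L2_space_iff)
  ultimately obtain r :: "nat \<Rightarrow> nat" where r: "strict_mono r"
    "AE x in \<mu>. (\<lambda>n. (cmod (G (r n) x - f x))\<^sup>2) \<longlonglongrightarrow> 0"
    using tendsto_L1_AE_subseq[of \<mu> "\<lambda>n x. (cmod (G n x - f x))\<^sup>2"] by blast
  show ?thesis
  proof (rule that[of "\<lambda>n. G (r n)"])
    show "(\<lambda>n. L2_norm \<mu> (\<lambda>x. G (r n) x - f x)) \<longlonglongrightarrow> 0"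
      using LIMSEQ_subseq_LIMSEQ[OF lim r(1)] by (simp add: o_def)
    show "AE x in \<mu>. (\<lambda>n. G (r n) x) \<longlonglongrightarrow> f x"
      using r(2)
    proof (rule AE_mp, intro AE_I2 impI)
      fix x assume "(\<lambda>n. (cmod (G (r n) x - f x))\<^sup>2) \<longlonglongrightarrow> 0"
      then have "(\<lambda>n. sqrt ((cmod (G (r n) x - f x))\<^sup>2)) \<longlonglongrightarrow> sqrt 0"
        by (rule tendsto_real_sqrt)
      then show "(\<lambda>n. G (r n) x) \<longlonglongrightarrow> f x"
        by (simp add: tendsto_norm_zero_iff LIM_zero_iff)
    qed
  qed (use G in auto)
qed

end

section \<open>Correlations and the U2 bound\<close>

context compact_haar begin

text \<open>Without a conjugate on \<open>h\<close> the correlation is bilinear, so that it suits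
  multilinear forms with unrelated entries; \<open>autocorr\<close> puts the conjugate back.\<close>

definition corr :: "('a \<Rightarrow> complex) \<Rightarrow> ('a \<Rightarrow> complex) \<Rightarrow> 'a \<Rightarrow> complex" where
  "corr g h w = (\<integral>y. g (w + y) * h y \<partial>\<mu>)"

abbreviation autocorr :: "('a \<Rightarrow> complex) \<Rightarrow> 'a \<Rightarrow> complex" where
  "autocorr g \<equiv> corr g (\<lambda>y. cnj (g y))"

lemma continuous_translate:
  "continuous_on UNIV g \<Longrightarrow> continuous_on UNIV (\<lambda>y. g (a + y))" for g :: "'a \<Rightarrow> 'b::topological_space"
  by (rule continuous_on_compose2[of UNIV g]) (auto intro: continuous_intros)

lemma L2_norm_translate:
  assumes "continuous_on UNIV g"
  shows "L2_norm \<mu> (\<lambda>y. g (a + y)) = L2_norm \<mu> g"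
proof -
  have "(\<lambda>x. (cmod (g x))\<^sup>2) \<in> borel_measurable \<mu>"
    using continuous_measurable[OF assms] by measurable
  from integral_add[OF this] show ?thesis
    by (simp add: L2_norm_def)
qed

lemma corr_bound:
  assumes g: "continuous_on UNIV g" and h: "continuous_on UNIV h"
  shows "cmod (corr g h w) \<le> L2_norm \<mu> g * L2_norm \<mu> h"
  unfolding corr_def
  using norm_integral_mult_le_L2[OF continuous_L2[OF continuous_translate[OF g, of w]] continuous_L2[OF h]]
  by (simp add: L2_norm_translate[OF g])

lemma corr_translate:
  assumes g: "continuous_on UNIV g" and h: "continuous_on UNIV h"
  shows "(\<integral>y. g (a + y) * h (b + y) \<partial>\<mu>) = corr g h (a - b)"
proof -
  have "(\<lambda>y. g (a - b + y) * h y) \<in> borel_measurable \<mu>"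
    by (intro continuous_measurable continuous_intros continuous_translate g h)
  from integral_add[OF this, of b] show ?thesis
    by (simp add: corr_def algebra_simps)
qed

lemma continuous_corr:
  assumes g: "continuous_on UNIV g" and h: "continuous_on UNIV h"
  shows "continuous_on UNIV (corr g h)"
  unfolding continuous_on_def
proof (intro ballI tendstoI)
  fix x :: 'a and e :: real assume e: "0 < e"
  obtain B where B: "\<And>x. cmod (h x) \<le> B"
    using continuous_bounded[OF h] by blast
  have B0: "0 \<le> B"
    using B[of 0] norm_ge_zero order_trans by blast
  \<comment> \<open>Division by \<open>B + 1\<close> avoids the case \<open>B = 0\<close> and makes
    the final estimate strict, as \<open>B / (B + 1) < 1\<close>.\<close>
  define d where "d = e / (B + 1)"
  have d: "0 < d" using e B0 by (simp add: d_def)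
  obtain U where U: "open U" "x \<in> U" "\<And>x' v. x' \<in> U \<Longrightarrow> dist (g (x' + v)) (g (x + v)) < d"
    by (rule uniformly_close_neighbourhood[OF g d, of x], rule that)
  have i: "integrable \<mu> (\<lambda>y. g (w + y) * h y)" for w
    by (intro L2_space_mult_integrable continuous_L2 continuous_translate g h)
  have "dist (corr g h x') (corr g h x) < e" if x': "x' \<in> U" for x'
  proof -
    have "dist (corr g h x') (corr g h x) = cmod (\<integral>y. (g (x' + y) - g (x + y)) * h y \<partial>\<mu>)"
      unfolding corr_def dist_norm by (subst Bochner_Integration.integral_diff[symmetric, OF i i]) (simp add: algebra_simps)
    also have "\<dots> \<le> (\<integral>y. d * B \<partial>\<mu>)"
    proof (rule norm_integral_le_integral)
      show "integrable \<mu> (\<lambda>y. (g (x' + y) - g (x + y)) * h y)"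
        using Bochner_Integration.integrable_diff[OF i[of x'] i[of x]] by (simp add: algebra_simps)
      show "cmod ((g (x' + y) - g (x + y)) * h y) \<le> d * B" for y
        using U(3)[OF x', of y] B[of y] B0 d unfolding norm_mult dist_norm
        by (intro mult_mono) auto
    qed simp
    also have "\<dots> = e * (B / (B + 1))"
      using prob_space by (simp add: d_def)
    also have "\<dots> < e * 1"
      using e B0 by (intro mult_strict_left_mono) auto
    also have "\<dots> = e" by simp
    finally show ?thesis .
  qed
  then show "\<forall>\<^sub>F x' in at x within UNIV. dist (corr g h x') (corr g h x) < e"
    unfolding eventually_at_topological using U(1,2) by blast
qed

text \<open>For continuous \<open>g\<close> this is the fourth power of the \<open>U\<^sup>2\<close> norm.\<close>

definition U2_energy :: "('a \<Rightarrow> complex) \<Rightarrow> real" where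
  "U2_energy g = (\<integral>w. (cmod (autocorr g w))\<^sup>2 \<partial>\<mu>)"

lemma continuous_autocorr: "continuous_on UNIV g \<Longrightarrow> continuous_on UNIV (autocorr g)"
  by (intro continuous_corr continuous_intros)

lemma U2_energy_nonneg: "0 \<le> U2_energy g"
  by (simp add: U2_energy_def)

text \<open>Cauchy-Schwarz bounds the autocorrelation pointwise by the squared L^2 norm, and the
  total mass is 1.\<close>

lemma U2_energy_le:
  assumes g: "continuous_on UNIV g"
  shows "sqrt (sqrt (U2_energy g)) \<le> L2_norm \<mu> g"
proof -
  have le: "cmod (autocorr g w) \<le> (L2_norm \<mu> g)\<^sup>2" for w
    using corr_bound[OF g continuous_on_cnj[OF g], of w] by (simp add: L2_norm_cnj power2_eq_square)
  have "U2_energy g \<le> (\<integral>w. ((L2_norm \<mu> g)\<^sup>2)\<^sup>2 \<partial>\<mu>)"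
    unfolding U2_energy_def
  proof (rule integral_mono)
    show "integrable \<mu> (\<lambda>w. (cmod (autocorr g w))\<^sup>2)"
      using continuous_L2[OF continuous_autocorr[OF g]] by (simp add: L2_space_iff)
    show "(cmod (autocorr g w))\<^sup>2 \<le> ((L2_norm \<mu> g)\<^sup>2)\<^sup>2" for w
      using le by (intro power_mono) auto
  qed simp
  also have "\<dots> = ((L2_norm \<mu> g)\<^sup>2)\<^sup>2"
    using prob_space by simp
  finally show ?thesis
    by (intro real_le_lsqrt) (auto simp: L2_norm_nonneg)
qed

lemma prob_space_pair: "prob_space (\<mu> \<Otimes>\<^sub>M \<mu>)"
proof -
  interpret pair_prob_space \<mu> \<mu> ..
  show ?thesis by (rule P.prob_space_axioms)
qed

lemma L2_norm_pair_mult: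
  assumes g: "continuous_on UNIV g" and h: "continuous_on UNIV h"
  shows "L2_norm (\<mu> \<Otimes>\<^sub>M \<mu>) (\<lambda>z. g (fst z) * h (snd z)) = L2_norm \<mu> g * L2_norm \<mu> h"
proof -
  obtain B C where B: "\<And>x. cmod (g x) \<le> B" and C: "\<And>x. cmod (h x) \<le> C"
    using continuous_bounded[OF g] continuous_bounded[OF h] by metis
  note [measurable] = continuous_measurable[OF g] continuous_measurable[OF h]
  have "cmod (g x) * cmod (h y) \<le> B * C" for x y
    using B C by (intro mult_mono) (auto intro: order_trans[OF norm_ge_zero])
  then have "(cmod (g x) * cmod (h y))\<^sup>2 \<le> (B * C)\<^sup>2" for x y
    by (intro power_mono) auto
  then have "(\<integral>z. (cmod (g (fst z) * h (snd z)))\<^sup>2 \<partial>(\<mu> \<Otimes>\<^sub>M \<mu>))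
      = (\<integral>x. (\<integral>y. (cmod (g x * h y))\<^sup>2 \<partial>\<mu>) \<partial>\<mu>)"
    by (subst integral_fst_bounded[OF prob_space_axioms prob_space_axioms, of _ "(B * C)\<^sup>2", symmetric])
      (auto simp: norm_mult)
  also have "\<dots> = (\<integral>x. (cmod (g x))\<^sup>2 \<partial>\<mu>) * (\<integral>y. (cmod (h y))\<^sup>2 \<partial>\<mu>)"
    by (simp add: norm_mult power_mult_distrib)
  finally show ?thesis
    by (simp add: L2_norm_def real_sqrt_mult)
qed

text \<open>The first Cauchy-Schwarz removes \<open>h\<close> and leaves the norm of the partial
  integral \<open>W\<close>. Expanding the squared norm duplicates the second variable; integrating
  the first variable turns the two copies of \<open>g\<close> into an autocorrelation at a
  difference, where \<open>v\<close> cancels. The second Cauchy-Schwarz separates the two copies of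
  \<open>k\<close> from it.\<close>

lemma bilinear_U2_bound:
  fixes \<alpha> \<beta> :: "'a \<Rightarrow> 'a"
  assumes \<alpha>: "\<alpha> \<in> borel_measurable \<mu>" "distr \<mu> borel \<alpha> = \<mu>"
    and \<beta>: "\<beta> \<in> borel_measurable \<mu>" "distr \<mu> borel \<beta> = \<mu>"
    and g: "continuous_on UNIV g" and h: "continuous_on UNIV h" and k: "continuous_on UNIV k"
  shows "cmod (\<integral>z. g (v + \<alpha> (fst z) + \<beta> (snd z)) * h (fst z) * k (snd z) \<partial>(\<mu> \<Otimes>\<^sub>M \<mu>))
    \<le> sqrt (sqrt (U2_energy g)) * L2_norm \<mu> h * L2_norm \<mu> k"
proof -
  let ?P = "\<mu> \<Otimes>\<^sub>M \<mu>"
  note P = prob_space_pair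
  note \<mu> = prob_space_axioms
  interpret P: prob_space ?P by (rule P)
  obtain B C D where B: "\<And>x. cmod (g x) \<le> B" and C: "\<And>x. cmod (h x) \<le> C" and D: "\<And>x. cmod (k x) \<le> D"
    using continuous_bounded[OF g] continuous_bounded[OF h] continuous_bounded[OF k] by metis
  have B0: "0 \<le> B" and D0: "0 \<le> D"
    using B[of 0] D[of 0] norm_ge_zero order_trans by blast+
  note [measurable] = continuous_measurable[OF g] continuous_measurable[OF h] continuous_measurable[OF k]
  have gv: "continuous_on UNIV (\<lambda>y. g (v + y))"
    using g by (rule continuous_translate)
  define a where "a y z = g (v + \<alpha> y + \<beta> z) * k z" for y z
  have ab: "cmod (a y z) \<le> B * D" for y z
    unfolding a_def norm_mult using B D B0 by (intro mult_mono) auto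
  have g_meas [measurable]: "(\<lambda>z. g (v + \<alpha> (fst z) + \<beta> (snd z))) \<in> borel_measurable ?P"
    using baire_measurableD[OF baire_measurable_add[OF \<alpha>(1) borel_measurable_imp_baire_measurable[OF \<beta>(1)]] gv]
    by (simp add: add.assoc)
  have a_meas [measurable]: "(\<lambda>z. a (fst z) (snd z)) \<in> borel_measurable ?P"
    unfolding a_def by measurable
  define W where "W y = (\<integral>z. a y z \<partial>\<mu>)" for y
  have W_meas: "W \<in> borel_measurable \<mu>"
    unfolding W_def by (rule borel_measurable_lebesgue_integral) (simp add: case_prod_unfold)
  have a_meas1: "a y \<in> borel_measurable \<mu>" for y
    using measurable_compose[OF measurable_Pair1'[of y \<mu> \<mu>] a_meas] by simp
  have W_bound: "cmod (W y) \<le> B * D" for y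
  proof -
    have "integrable \<mu> (a y)"
      using ab a_meas1 by (intro integrable_const_bound[of _ "B * D"]) auto
    then have "cmod (W y) \<le> (\<integral>z. B * D \<partial>\<mu>)"
      unfolding W_def by (intro norm_integral_le_integral ab) auto
    then show ?thesis using prob_space by simp
  qed
  have W_L2: "W \<in> L2_space \<mu>"
    using W_meas W_bound by (rule L2_space_bounded)
  have "(\<integral>z. g (v + \<alpha> (fst z) + \<beta> (snd z)) * h (fst z) * k (snd z) \<partial>?P)
      = (\<integral>z. h (fst z) * a (fst z) (snd z) \<partial>?P)"
    by (simp add: a_def mult_ac)
  also have "\<dots> = (\<integral>y. (\<integral>z. h y * a y z \<partial>\<mu>) \<partial>\<mu>)"
  proof (subst integral_fst_bounded[OF \<mu> \<mu>, of _ "C * (B * D)", symmetric])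
    show "cmod (h (fst z) * a (fst z) (snd z)) \<le> C * (B * D)" for z
      unfolding norm_mult[of "h _"] using C ab by (intro mult_mono) (auto intro: order_trans[OF norm_ge_zero])
  qed simp_all
  also have "\<dots> = (\<integral>y. h y * W y \<partial>\<mu>)"
    by (simp add: W_def)
  finally have 1: "cmod (\<integral>z. g (v + \<alpha> (fst z) + \<beta> (snd z)) * h (fst z) * k (snd z) \<partial>?P)
      \<le> L2_norm \<mu> h * L2_norm \<mu> W"
    using norm_integral_mult_le_L2[OF continuous_L2[OF h] W_L2] by simp
  define Q where "Q z = autocorr g (\<beta> (fst z) - \<beta> (snd z))" for z
  define K where "K z = k (fst z) * cnj (k (snd z))" for z
  have Q_meas: "Q \<in> borel_measurable ?P"
  proof -
    have "(\<lambda>y. - y) \<in> borel_measurable (borel :: 'a measure)"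
      by (intro borel_measurable_continuous_onI continuous_intros)
    then have "(\<lambda>y. - \<beta> y) \<in> borel_measurable \<mu>"
      by (rule measurable_compose[OF \<beta>(1)])
    from baire_measurableD[OF baire_measurable_add[OF \<beta>(1) borel_measurable_imp_baire_measurable[OF this]]
        continuous_autocorr[OF g]]
    show ?thesis by (simp add: Q_def[abs_def])
  qed
  have Q_bound: "cmod (Q z) \<le> L2_norm \<mu> g * L2_norm \<mu> g" for z
    using corr_bound[OF g continuous_on_cnj[OF g]] by (simp add: Q_def L2_norm_cnj)
  have Q_L2: "Q \<in> L2_space ?P"
    using Q_meas Q_bound by (rule P.L2_space_bounded)
  have cnj_meas [measurable]: "(\<lambda>x. cnj (k x)) \<in> borel_measurable \<mu>"
    by (intro continuous_measurable continuous_intros k)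
  have K_meas: "K \<in> borel_measurable ?P"
    unfolding K_def by measurable
  have K_L2: "K \<in> L2_space ?P"
    using K_meas
  proof (rule P.L2_space_bounded)
    show "cmod (K z) \<le> D * D" for z
      unfolding K_def norm_mult complex_mod_cnj using D D0 by (intro mult_mono) auto
  qed
  \<comment> \<open>For a fixed second variable, the argument of the autocorrelation is a translate
    of \<open>\<beta>\<close> and hence Haar distributed, so each inner integral is already the full
    energy.\<close>
  have Q_norm: "(L2_norm ?P Q)\<^sup>2 = U2_energy g"
  proof -
    have m: "(\<lambda>z. (cmod (Q z))\<^sup>2) \<in> borel_measurable ?P"
      using Q_meas by measurable
    have "(cmod (Q z))\<^sup>2 \<le> (L2_norm \<mu> g * L2_norm \<mu> g)\<^sup>2" for z
      using Q_bound by (intro power_mono) auto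
    then have b: "norm ((cmod (Q z))\<^sup>2) \<le> (L2_norm \<mu> g * L2_norm \<mu> g)\<^sup>2" for z
      by simp
    have inner: "(\<integral>x. (cmod (Q (x, y)))\<^sup>2 \<partial>\<mu>) = U2_energy g" for y
    proof -
      have m1: "(\<lambda>w. (cmod (autocorr g w))\<^sup>2) \<in> borel_measurable \<mu>"
        by (intro continuous_measurable continuous_intros continuous_autocorr g)
      have m2: "(\<lambda>w. (cmod (autocorr g (- \<beta> y + w)))\<^sup>2) \<in> borel_measurable \<mu>"
        by (intro continuous_measurable continuous_intros continuous_translate continuous_autocorr g)
      have "(\<integral>x. (cmod (Q (x, y)))\<^sup>2 \<partial>\<mu>) = (\<integral>x. (cmod (autocorr g (- \<beta> y + \<beta> x)))\<^sup>2 \<partial>\<mu>)"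
        by (simp add: Q_def)
      also have "\<dots> = (\<integral>x. (cmod (autocorr g (- \<beta> y + x)))\<^sup>2 \<partial>\<mu>)"
        by (rule integral_pushforward[OF \<beta>(2,1) m2])
      also have "\<dots> = U2_energy g"
        unfolding U2_energy_def by (rule integral_add[OF m1])
      finally show ?thesis .
    qed
    have "(L2_norm ?P Q)\<^sup>2 = (\<integral>y. (\<integral>x. (cmod (Q (x, y)))\<^sup>2 \<partial>\<mu>) \<partial>\<mu>)"
      unfolding L2_norm_power2 integral_swap_bounded[OF \<mu> \<mu> m b] integral_fst_bounded[OF \<mu> \<mu> m b] ..
    also have "\<dots> = U2_energy g"
      using prob_space by (simp add: inner)
    finally show ?thesis .
  qed
  have K_norm: "L2_norm ?P K = (L2_norm \<mu> k)\<^sup>2"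
    unfolding K_def using L2_norm_pair_mult[OF k continuous_on_cnj[OF k]]
    by (simp add: L2_norm_cnj power2_eq_square)
  \<comment> \<open>\<open>\<Theta>\<close> is the integrand of \<open>W y * cnj (W y)\<close>
    written as one integral over pairs, so that Fubini can integrate over \<open>y\<close>
    first.\<close>
  define \<Theta> where "\<Theta> u = a (fst u) (fst (snd u)) * cnj (a (fst u) (snd (snd u)))" for u
  have \<Theta>_bound: "cmod (\<Theta> u) \<le> (B * D) * (B * D)" for u
    unfolding \<Theta>_def norm_mult[of "a _ _"] complex_mod_cnj
    using ab by (intro mult_mono) (auto intro: order_trans[OF norm_ge_zero])
  have \<Theta>_meas: "\<Theta> \<in> borel_measurable (\<mu> \<Otimes>\<^sub>M ?P)"
  proof -
    have 1: "(\<lambda>u. (fst u, fst (snd u))) \<in> measurable (\<mu> \<Otimes>\<^sub>M ?P) ?P"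
      and 2: "(\<lambda>u. (fst u, snd (snd u))) \<in> measurable (\<mu> \<Otimes>\<^sub>M ?P) ?P"
      by measurable
    show ?thesis
      unfolding \<Theta>_def
      using measurable_compose[OF 1 a_meas] borel_measurable_cnj[OF measurable_compose[OF 2 a_meas]]
      by simp
  qed
  have WW: "W y * cnj (W y) = (\<integral>z. \<Theta> (y, z) \<partial>?P)" for y
  proof -
    have m: "(\<lambda>z. \<Theta> (y, z)) \<in> borel_measurable ?P"
      using measurable_compose[OF measurable_Pair1'[of y \<mu> ?P] \<Theta>_meas] by simp
    have "(\<integral>z. \<Theta> (y, z) \<partial>?P) = (\<integral>z. (\<integral>z'. \<Theta> (y, (z, z')) \<partial>\<mu>) \<partial>\<mu>)"
      by (rule integral_fst_bounded[OF \<mu> \<mu> m \<Theta>_bound, symmetric])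
    also have "\<dots> = W y * cnj (W y)"
      unfolding \<Theta>_def W_def by simp
    finally show ?thesis by simp
  qed
  have inner: "(\<integral>y. \<Theta> (y, z) \<partial>\<mu>) = K z * Q z" for z
  proof -
    have c: "continuous_on UNIV (\<lambda>y. cnj (g y))"
      by (intro continuous_intros g)
    have m: "(\<lambda>y. g (v + \<beta> (fst z) + y) * cnj (g (v + \<beta> (snd z) + y))) \<in> borel_measurable \<mu>"
      by (intro continuous_measurable continuous_intros continuous_translate g)
    have "(\<integral>y. \<Theta> (y, z) \<partial>\<mu>)
        = (\<integral>y. K z * (g (v + \<beta> (fst z) + \<alpha> y) * cnj (g (v + \<beta> (snd z) + \<alpha> y))) \<partial>\<mu>)"
      by (simp add: \<Theta>_def a_def K_def algebra_simps)
    also have "\<dots> = K z * (\<integral>y. g (v + \<beta> (fst z) + \<alpha> y) * cnj (g (v + \<beta> (snd z) + \<alpha> y)) \<partial>\<mu>)"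
      by simp
    also have "\<dots> = K z * (\<integral>y. g (v + \<beta> (fst z) + y) * cnj (g (v + \<beta> (snd z) + y)) \<partial>\<mu>)"
      using integral_pushforward[OF \<alpha>(2,1) m] by simp
    also have "\<dots> = K z * Q z"
      using corr_translate[OF g c] by (simp add: Q_def)
    finally show ?thesis .
  qed
  have "complex_of_real ((L2_norm \<mu> W)\<^sup>2) = (\<integral>y. W y * cnj (W y) \<partial>\<mu>)"
  proof -
    have "W y * cnj (W y) = complex_of_real ((cmod (W y))\<^sup>2)" for y
      by (simp only: complex_norm_square)
    then show ?thesis
      by (simp only: L2_norm_power2 integral_complex_of_real)
  qed
  also have "\<dots> = (\<integral>y. (\<integral>z. \<Theta> (y, z) \<partial>?P) \<partial>\<mu>)"
    by (simp add: WW)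
  also have "\<dots> = (\<integral>z. (\<integral>y. \<Theta> (y, z) \<partial>\<mu>) \<partial>?P)"
    by (rule integral_swap_bounded[OF \<mu> P \<Theta>_meas \<Theta>_bound, symmetric])
  also have "\<dots> = (\<integral>z. K z * Q z \<partial>?P)"
    by (simp add: inner)
  finally have "cmod (complex_of_real ((L2_norm \<mu> W)\<^sup>2)) \<le> L2_norm ?P K * L2_norm ?P Q"
    using norm_integral_mult_le_L2[OF K_L2 Q_L2] by simp
  then have "(L2_norm \<mu> W)\<^sup>2 \<le> (L2_norm \<mu> k)\<^sup>2 * L2_norm ?P Q"
    by (simp add: K_norm norm_power)
  also have "L2_norm ?P Q = sqrt (U2_energy g)"
    unfolding Q_norm[symmetric] by (simp add: L2_norm_nonneg)
  finally have "L2_norm \<mu> W \<le> sqrt ((L2_norm \<mu> k)\<^sup>2 * sqrt (U2_energy g))"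
    by (rule real_le_rsqrt)
  also have "\<dots> = L2_norm \<mu> k * sqrt (sqrt (U2_energy g))"
    by (simp add: real_sqrt_mult L2_norm_nonneg)
  finally have "L2_norm \<mu> h * L2_norm \<mu> W \<le> L2_norm \<mu> h * (L2_norm \<mu> k * sqrt (sqrt (U2_energy g)))"
    by (intro mult_left_mono L2_norm_nonneg)
  with 1 show ?thesis
    by (simp add: mult_ac)
qed

end

section \<open>Extension of multilinear forms from continuous to square-integrable functions\<close>

text \<open>The bound assumed for continuous functions passes to \<open>L\<^sup>2\<close> functions by Fatou's lemma,
  and then multilinearity turns it into continuity of the form.\<close>

locale L2_bounded_form = compact_haar \<mu>
  for \<mu> :: "'a::{topological_ab_group_add,t2_space} measure" +
  fixes M :: "'b measure" and p :: "'i::finite \<Rightarrow> 'b \<Rightarrow> 'a"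
  assumes prob_M: "prob_space M"
    and p_measurable: "\<And>i. p i \<in> borel_measurable M"
    and distr_p: "\<And>i. distr M borel (p i) = \<mu>"
    and continuous_bound: "\<And>g. (\<And>i. continuous_on UNIV (g i)) \<Longrightarrow>
      cmod (\<integral>x. (\<Prod>i\<in>UNIV. g i (p i x)) \<partial>M) \<le> (\<Prod>i\<in>UNIV. L2_norm \<mu> (g i))"
begin

lemma form_measurable:
  assumes "\<And>i. f i \<in> L2_space \<mu>"
  shows "(\<lambda>x. \<Prod>i\<in>UNIV. f i (p i x) :: complex) \<in> borel_measurable M"
proof (intro borel_measurable_prod)
  fix i
  have "f i \<in> borel_measurable borel"
    using assms[of i] by (simp add: L2_space_iff measurable_haar_iff)
  then show "(\<lambda>x. f i (p i x)) \<in> borel_measurable M"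
    by (rule measurable_compose[OF p_measurable])
qed

text \<open>Absolute values may be put inside the integral because the functions
  \<open>cmod (g i x)\<close> are again continuous and have the same L^2 norms. Fatou's lemma
  requires this nonnegative version.\<close>

lemma nn_integral_continuous_bound:
  assumes g: "\<And>i. continuous_on UNIV (g i)"
  shows "(\<integral>\<^sup>+x. ennreal (\<Prod>i\<in>UNIV. cmod (g i (p i x))) \<partial>M) \<le> ennreal (\<Prod>i\<in>UNIV. L2_norm \<mu> (g i))"
proof -
  interpret M: prob_space M by (rule prob_M)
  have "\<forall>i. \<exists>B. \<forall>x. cmod (g i x) \<le> B"
    using continuous_bounded[OF g] by blast
  from choice[OF this] obtain B where B: "\<And>i x. cmod (g i x) \<le> B i"
    by blast
  have meas: "(\<lambda>x. \<Prod>i\<in>UNIV. g i (p i x)) \<in> borel_measurable M"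
    using g by (intro form_measurable continuous_L2)
  have "integrable M (\<lambda>x. \<Prod>i\<in>UNIV. g i (p i x))"
    by (rule M.integrable_const_bound[of _ "\<Prod>i\<in>UNIV. B i"])
      (auto simp: prod_norm[symmetric] intro!: prod_mono B meas)
  then have "integrable M (\<lambda>x. \<Prod>i\<in>UNIV. cmod (g i (p i x)))"
    using integrable_norm by (fastforce simp: prod_norm)
  then have "(\<integral>\<^sup>+x. ennreal (\<Prod>i\<in>UNIV. cmod (g i (p i x))) \<partial>M)
      = ennreal (\<integral>x. (\<Prod>i\<in>UNIV. cmod (g i (p i x))) \<partial>M)"
    by (intro nn_integral_eq_integral) (auto intro!: AE_I2 prod_nonneg)
  also have "(\<integral>x. (\<Prod>i\<in>UNIV. cmod (g i (p i x))) \<partial>M)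
      \<le> cmod (complex_of_real (\<integral>x. (\<Prod>i\<in>UNIV. cmod (g i (p i x))) \<partial>M))"
    by simp
  also have "complex_of_real (\<integral>x. (\<Prod>i\<in>UNIV. cmod (g i (p i x))) \<partial>M)
      = (\<integral>x. (\<Prod>i\<in>UNIV. complex_of_real (cmod (g i (p i x)))) \<partial>M)"
    by (simp flip: of_real_prod)
  also have "cmod \<dots> \<le> (\<Prod>i\<in>UNIV. L2_norm \<mu> (\<lambda>x. complex_of_real (cmod (g i x))))"
    by (rule continuous_bound) (intro continuous_intros g)
  finally show ?thesis
    by (simp add: L2_norm_norm ennreal_leI)
qed

lemma nn_integral_form_bound:
  assumes f: "\<And>i. f i \<in> L2_space \<mu>"
  shows "(\<integral>\<^sup>+x. ennreal (\<Prod>i\<in>UNIV. cmod (f i (p i x))) \<partial>M) \<le> ennreal (\<Prod>i\<in>UNIV. L2_norm \<mu> (f i))"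
proof -
  define R where "R i F \<longleftrightarrow> (\<forall>n. continuous_on UNIV (F n)) \<and>
    (\<lambda>n. L2_norm \<mu> (\<lambda>x. F n x - f i x)) \<longlonglongrightarrow> 0 \<and> (AE x in \<mu>. (\<lambda>n. F n x) \<longlonglongrightarrow> f i x)" for i F
  have "\<forall>i. \<exists>F. R i F"
  proof
    fix i
    obtain F where "\<And>n. continuous_on UNIV (F n)" "(\<lambda>n. L2_norm \<mu> (\<lambda>x. F n x - f i x)) \<longlonglongrightarrow> 0"
      "AE x in \<mu>. (\<lambda>n. F n x) \<longlonglongrightarrow> f i x"
      by (rule continuous_approx_seq[OF f[of i]], rule that)
    then have "R i F"
      by (simp add: R_def)
    then show "\<exists>F. R i F" by blast
  qed
  from choice[OF this] obtain F where R: "\<forall>i. R i (F i)" ..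
  have cont: "continuous_on UNIV (F i n)" for i n
    using R by (simp add: R_def)
  have lim: "(\<lambda>n. L2_norm \<mu> (\<lambda>x. F i n x - f i x)) \<longlonglongrightarrow> 0" for i
    using R by (simp add: R_def)
  \<comment> \<open>Null sets of \<open>\<mu>\<close> pull back to null sets of \<open>M\<close>,
    since \<open>p i\<close> pushes \<open>M\<close> forward to \<open>\<mu>\<close>.\<close>
  have ae: "AE x in M. (\<lambda>n. F i n (p i x)) \<longlonglongrightarrow> f i (p i x)" for i
  proof (rule AE_distrD[OF p_measurable[of i]])
    show "AE x in distr M borel (p i). (\<lambda>n. F i n x) \<longlonglongrightarrow> f i x"
      unfolding distr_p using R unfolding R_def by blast
  qed
  have "AE x in M. \<forall>i\<in>UNIV. (\<lambda>n. F i n (p i x)) \<longlonglongrightarrow> f i (p i x)"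
    using ae by (intro AE_finite_allI) auto
  then have ae': "AE x in M. ennreal (\<Prod>i\<in>UNIV. cmod (f i (p i x)))
      = liminf (\<lambda>n. ennreal (\<Prod>i\<in>UNIV. cmod (F i n (p i x))))"
  proof (rule AE_mp, intro AE_I2 impI)
    fix x assume x: "\<forall>i\<in>UNIV. (\<lambda>n. F i n (p i x)) \<longlonglongrightarrow> f i (p i x)"
    have "(\<lambda>n. ennreal (\<Prod>i\<in>UNIV. cmod (F i n (p i x)))) \<longlonglongrightarrow> ennreal (\<Prod>i\<in>UNIV. cmod (f i (p i x)))"
      using x by (intro tendsto_ennrealI tendsto_prod tendsto_norm) auto
    then show "ennreal (\<Prod>i\<in>UNIV. cmod (f i (p i x)))
        = liminf (\<lambda>n. ennreal (\<Prod>i\<in>UNIV. cmod (F i n (p i x))))"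
      by (intro lim_imp_Liminf[symmetric]) auto
  qed
  have meas: "(\<lambda>x. ennreal (\<Prod>i\<in>UNIV. cmod (F i n (p i x)))) \<in> borel_measurable M" for n
  proof -
    have "(\<lambda>x. \<Prod>i\<in>UNIV. F i n (p i x)) \<in> borel_measurable M"
      using cont by (intro form_measurable continuous_L2)
    then have "(\<lambda>x. cmod (\<Prod>i\<in>UNIV. F i n (p i x))) \<in> borel_measurable M"
      by measurable
    then show ?thesis by (simp add: prod_norm)
  qed
  have "(\<integral>\<^sup>+x. ennreal (\<Prod>i\<in>UNIV. cmod (f i (p i x))) \<partial>M)
      = (\<integral>\<^sup>+x. liminf (\<lambda>n. ennreal (\<Prod>i\<in>UNIV. cmod (F i n (p i x)))) \<partial>M)"
    using ae' by (rule nn_integral_cong_AE)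
  also have "\<dots> \<le> liminf (\<lambda>n. \<integral>\<^sup>+x. ennreal (\<Prod>i\<in>UNIV. cmod (F i n (p i x))) \<partial>M)"
    using meas by (rule nn_integral_liminf)
  also have "\<dots> \<le> liminf (\<lambda>n. ennreal (\<Prod>i\<in>UNIV. L2_norm \<mu> (F i n)))"
    using cont by (intro Liminf_mono always_eventually allI nn_integral_continuous_bound)
  also have "\<dots> = ennreal (\<Prod>i\<in>UNIV. L2_norm \<mu> (f i))"
    using tendsto_L2_norm[OF continuous_L2[OF cont] f lim]
    by (intro lim_imp_Liminf tendsto_ennrealI tendsto_prod) auto
  finally show ?thesis .
qed

text \<open>The estimate on nonnegative integrals supplies the finiteness that makes the product
  integrable, and only then does the complex integral inherit the bound.\<close>

lemma
  assumes f: "\<And>i. f i \<in> L2_space \<mu>"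
  shows form_integrable: "integrable M (\<lambda>x. \<Prod>i\<in>UNIV. f i (p i x))"
    and form_bound: "cmod (\<integral>x. (\<Prod>i\<in>UNIV. f i (p i x)) \<partial>M) \<le> (\<Prod>i\<in>UNIV. L2_norm \<mu> (f i))"
proof -
  have b: "(\<integral>\<^sup>+x. ennreal (cmod (\<Prod>i\<in>UNIV. f i (p i x))) \<partial>M) \<le> ennreal (\<Prod>i\<in>UNIV. L2_norm \<mu> (f i))"
    using nn_integral_form_bound[OF f] by (simp add: prod_norm)
  show i: "integrable M (\<lambda>x. \<Prod>i\<in>UNIV. f i (p i x))"
    using form_measurable[OF f] le_less_trans[OF b] by (intro integrableI_bounded) auto
  have "ennreal (cmod (\<integral>x. (\<Prod>i\<in>UNIV. f i (p i x)) \<partial>M)) \<le> ennreal (\<Prod>i\<in>UNIV. L2_norm \<mu> (f i))"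
    using integral_norm_bound_ennreal[OF i] b by (rule order_trans)
  then show "cmod (\<integral>x. (\<Prod>i\<in>UNIV. f i (p i x)) \<partial>M) \<le> (\<Prod>i\<in>UNIV. L2_norm \<mu> (f i))"
    by (subst (asm) ennreal_le_iff) (auto intro: prod_nonneg L2_norm_nonneg)
qed

text \<open>The functions are exchanged one index at a time: \<open>h J\<close> has the approximants
  at the indices in \<open>J\<close> and the limits elsewhere.\<close>

lemma form_tendsto:
  assumes F: "\<And>i n. F i n \<in> L2_space \<mu>" and f: "\<And>i. f i \<in> L2_space \<mu>"
    and lim: "\<And>i. (\<lambda>n. L2_norm \<mu> (\<lambda>x. F i n x - f i x)) \<longlonglongrightarrow> 0"
  shows "(\<lambda>n. \<integral>x. (\<Prod>i\<in>UNIV. F i n (p i x)) \<partial>M) \<longlonglongrightarrow> (\<integral>x. (\<Prod>i\<in>UNIV. f i (p i x)) \<partial>M)"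
proof -
  define h where "h J i n = (if i \<in> J then F i n else f i)" for J i n
  have hL2: "h J i n \<in> L2_space \<mu>" for J i n
    using F f by (simp add: h_def)
  have "(\<lambda>n. \<integral>x. (\<Prod>i\<in>UNIV. h J i n (p i x)) \<partial>M) \<longlonglongrightarrow> (\<integral>x. (\<Prod>i\<in>UNIV. f i (p i x)) \<partial>M)"
    if "finite J" for J
    using that
  proof (induction J rule: finite_induct)
    case empty
    then show ?case by (simp add: h_def)
  next
    case (insert j J)
    \<comment> \<open>By multilinearity the change caused by index \<open>j\<close> is the form with
      a difference in place \<open>j\<close>. The norm of that entry tends to 0 while the other
      norms converge.\<close>
    define k where "k i n = (if i = j then (\<lambda>x. F j n x - f j x) else h J i n)" for i n
    have kL2: "k i n \<in> L2_space \<mu>" for i n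
      unfolding k_def using hL2 L2_space_diff[OF F f] by simp
    have split: "(\<Prod>i\<in>UNIV. u i) = u j * (\<Prod>i\<in>UNIV - {j}. u i)" for u :: "'i \<Rightarrow> complex"
      by (intro prod.remove) auto
    have "(\<Prod>i\<in>UNIV. h (insert j J) i n (p i x)) - (\<Prod>i\<in>UNIV. h J i n (p i x))
        = (\<Prod>i\<in>UNIV. k i n (p i x))" for n x
    proof -
      have "(\<Prod>i\<in>UNIV - {j}. h (insert j J) i n (p i x)) = (\<Prod>i\<in>UNIV - {j}. h J i n (p i x))"
        "(\<Prod>i\<in>UNIV - {j}. k i n (p i x)) = (\<Prod>i\<in>UNIV - {j}. h J i n (p i x))"
        by (auto simp: h_def k_def intro!: prod.cong)
      moreover have "h (insert j J) j n = F j n" "h J j n = f j"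
        using insert.hyps by (auto simp: h_def)
      ultimately show ?thesis
        unfolding split by (simp add: k_def algebra_simps)
    qed
    then have "(\<integral>x. (\<Prod>i\<in>UNIV. h (insert j J) i n (p i x)) \<partial>M) - (\<integral>x. (\<Prod>i\<in>UNIV. h J i n (p i x)) \<partial>M)
        = (\<integral>x. (\<Prod>i\<in>UNIV. k i n (p i x)) \<partial>M)" for n
      using form_integrable[OF hL2] by (subst Bochner_Integration.integral_diff[symmetric]) auto
    then have diff: "cmod ((\<integral>x. (\<Prod>i\<in>UNIV. h (insert j J) i n (p i x)) \<partial>M)
        - (\<integral>x. (\<Prod>i\<in>UNIV. h J i n (p i x)) \<partial>M)) \<le> (\<Prod>i\<in>UNIV. L2_norm \<mu> (k i n))" for n
      using form_bound[OF kL2] by simp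
    have "(\<lambda>n. L2_norm \<mu> (k i n)) \<longlonglongrightarrow> (if i = j then 0 else L2_norm \<mu> (f i))" for i
      using lim[of j] tendsto_L2_norm[OF F f lim, of i] by (cases "i \<in> J") (auto simp: k_def h_def)
    then have "(\<lambda>n. \<Prod>i\<in>UNIV. L2_norm \<mu> (k i n)) \<longlonglongrightarrow> (\<Prod>i\<in>UNIV. if i = j then 0 else L2_norm \<mu> (f i))"
      by (intro tendsto_prod)
    also have "(\<Prod>i\<in>UNIV. if i = j then 0 else L2_norm \<mu> (f i)) = 0"
      by (intro prod_zero) auto
    finally have "(\<lambda>n. (\<integral>x. (\<Prod>i\<in>UNIV. h (insert j J) i n (p i x)) \<partial>M)
        - (\<integral>x. (\<Prod>i\<in>UNIV. h J i n (p i x)) \<partial>M)) \<longlonglongrightarrow> 0"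
      by (rule Lim_null_comparison[OF always_eventually, rotated]) (use diff in auto)
    from tendsto_add[OF this insert.IH] show ?case by simp
  qed
  from this[of UNIV] show ?thesis
    by (simp add: h_def)
qed

end

section \<open>The kernel of a linear form\<close>

lemma nat_mult_add: "nat_mult n (x + y) = nat_mult n x + nat_mult n (y::'a::ab_group_add)"
  by (induction n) (simp_all add: algebra_simps)

lemma int_mult_add: "int_mult c (x + y) = int_mult c x + int_mult c (y::'a::ab_group_add)"
  by (simp add: int_mult_def nat_mult_add)

lemma int_mult_0_right: "int_mult c (0::'a::ab_group_add) = 0"
  using int_mult_add[of c 0 0] by simp

lemma int_mult_minus: "int_mult c (- x) = - int_mult c (x::'a::ab_group_add)"
  using int_mult_add[of c "- x" x] by (simp add: int_mult_0_right eq_neg_iff_add_eq_0)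

lemma additive_nat_mult:
  assumes "\<And>x y. \<phi> (x + y) = \<phi> x + (\<phi> y :: 'b::ab_group_add)"
  shows "\<phi> (nat_mult n x) = nat_mult n (\<phi> (x::'a::ab_group_add))"
proof (induction n)
  case 0
  show ?case using assms[of 0 0] by simp
qed (simp add: assms)

lemma int_mult_commute: "int_mult a (int_mult b x) = int_mult b (int_mult a (x::'a::ab_group_add))"
proof -
  have n: "int_mult a (nat_mult m y) = nat_mult m (int_mult a y)" for m and y :: 'a
    by (rule additive_nat_mult) (rule int_mult_add)
  show ?thesis
    by (simp add: int_mult_def[of b] n int_mult_minus)
qed

lemma continuous_on_nat_mult:
  "continuous_on UNIV (nat_mult n :: 'a::topological_ab_group_add \<Rightarrow> 'a)"
  by (induction n) (auto intro!: continuous_intros)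

lemma continuous_on_int_mult:
  "continuous_on UNIV (int_mult c :: 'a::topological_ab_group_add \<Rightarrow> 'a)"
proof (cases "0 \<le> c")
  case True
  then have "(int_mult c :: 'a \<Rightarrow> 'a) = nat_mult (nat c)"
    by (auto simp: int_mult_def)
  then show ?thesis
    by (simp add: continuous_on_nat_mult)
next
  case False
  then have "(int_mult c :: 'a \<Rightarrow> 'a) = (\<lambda>x. - nat_mult (nat (- c)) x)"
    by (auto simp: int_mult_def)
  then show ?thesis
    by (simp add: continuous_on_minus continuous_on_nat_mult)
qed

lemma linear_form_add: "linear_form c (x + y) = linear_form c x + linear_form c y"
  by (simp add: linear_form_def int_mult_add sum.distrib)

lemma linear_form_minus: "linear_form c (- x) = - linear_form c x"
  by (simp add: linear_form_def int_mult_minus sum_negf)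

lemma add_subgroup_form_kernel: "add_subgroup (form_kernel c)"
proof -
  have "linear_form c 0 = 0"
    using linear_form_add[of c 0 0] by simp
  then show ?thesis
    by (auto simp: add_subgroup_def form_kernel_def linear_form_add linear_form_minus)
qed

definition kernel_vector :: "('n::finite \<Rightarrow> int) \<Rightarrow> 'n \<Rightarrow> 'n \<Rightarrow> 'a::ab_group_add \<Rightarrow> 'a ^ 'n" where
  "kernel_vector c i j u =
    (\<chi> l. if l = i then - int_mult (c j) u else if l = j then int_mult (c i) u else 0)"

lemma kernel_vector_in_kernel:
  assumes "i \<noteq> j"
  shows "kernel_vector c i j u \<in> form_kernel c"
proof -
  let ?t = "\<lambda>l. int_mult (c l) (kernel_vector c i j u $ l)"
  have "linear_form c (kernel_vector c i j u) = (\<Sum>l\<in>{i, j}. ?t l)"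
    unfolding linear_form_def
    by (rule sum.mono_neutral_right) (auto simp: kernel_vector_def int_mult_0_right)
  also have "\<dots> = 0"
    using assms by (simp add: kernel_vector_def int_mult_minus int_mult_commute[of "c i" "c j"])
  finally show ?thesis
    by (simp add: form_kernel_def)
qed

lemma continuous_on_vec_nth: "continuous_on UNIV (\<lambda>x::'a::topological_space ^ 'n. x $ i)"
  unfolding continuous_on_def by (auto intro: tendsto_vec_nth tendsto_ident_at)

lemma continuous_on_vec_add:
  "continuous_on UNIV ((+) (a :: 'a::topological_ab_group_add ^ 'n))"
proof -
  have "((\<lambda>x. \<chi> l. a $ l + x $ l) \<longlongrightarrow> (\<chi> l. a $ l + x $ l)) (at x within UNIV)" for x :: "'a ^ 'n"
    by (intro tendsto_vec_lambda tendsto_add tendsto_const tendsto_vec_nth tendsto_ident_at)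
  then show ?thesis
    unfolding continuous_on_def plus_vec_def by blast
qed

section \<open>Haar measure on the kernel and the bound for continuous functions\<close>

locale kernel_haar = compact_haar \<mu>
  for \<mu> :: "'a::{topological_ab_group_add,t2_space} measure" +
  fixes c :: "'n::finite \<Rightarrow> int" and \<kappa> :: "('a ^ 'n) measure"
  assumes three_le_card: "CARD('n) \<ge> 3"
    and surj: "\<And>i. range (int_mult (c i) :: 'a \<Rightarrow> 'a) = UNIV"
    and haar_kernel: "haar_probability (form_kernel c) \<kappa>"
begin

lemma prob_kernel: "prob_space \<kappa>"
  using haar_kernel by (rule haar_probability_prob_space)

lemma coordinate_measurable: "(\<lambda>x. x $ i) \<in> borel_measurable \<kappa>"
  using haar_kernel continuous_on_vec_nth by (rule haar_probability_continuous_measurable)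

text \<open>Having at least three variables guarantees two coordinates besides \<open>i\<close>,
  hence two kernel directions that both move \<open>i\<close> but otherwise move different
  coordinates.\<close>

lemma obtain_other:
  assumes "card A < 3"
  obtains j :: 'n where "j \<notin> A"
proof -
  have "A \<noteq> UNIV"
    using assms three_le_card by auto
  then show ?thesis
    using that by blast
qed

lemma distr_coordinate: "distr \<kappa> borel (\<lambda>x. x $ i) = \<mu>"
proof (rule haar_pushforward[OF haar_kernel add_subgroup_form_kernel continuous_on_vec_nth])
  obtain j where j: "j \<noteq> i"
    using obtain_other[of "{i}"] by auto
  have "a \<in> (\<lambda>x. x $ i) ` form_kernel c" for a :: 'a
  proof -
    \<comment> \<open>The kernel vector has \<open>- int_mult (c j) u\<close> in place
      \<open>i\<close>, which is then \<open>a\<close>.\<close>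
    obtain u where "int_mult (c j) u = - a"
      using surj[of j] by (metis UNIV_I imageE)
    then show ?thesis
      using kernel_vector_in_kernel[of i j c u] j
      by (intro image_eqI[of _ _ "kernel_vector c i j u"]) (auto simp: kernel_vector_def)
  qed
  then show "(\<lambda>x. x $ i) ` form_kernel c = (UNIV :: 'a set)"
    by blast
qed simp

lemma distr_int_mult: "distr \<mu> borel (int_mult (c i)) = \<mu>"
  by (rule haar_pushforward[OF haar]) (auto simp: add_subgroup_def continuous_on_int_mult int_mult_add surj)

lemma distr_minus_int_mult: "distr \<mu> borel (\<lambda>u. - int_mult (c i) u) = \<mu>"
proof (rule haar_pushforward[OF haar])
  have "a \<in> range (\<lambda>u. - int_mult (c i) u)" for a :: 'a
  proof -
    obtain u where "- a = int_mult (c i) u"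
      using surj[of i] by (metis UNIV_I imageE)
    then show ?thesis
      by (intro image_eqI[of _ _ u]) (simp_all flip: \<open>- a = int_mult (c i) u\<close>)
  qed
  then show "range (\<lambda>u. - int_mult (c i) u) = (UNIV :: 'a set)"
    by blast
qed (auto simp: add_subgroup_def int_mult_add intro!: continuous_intros continuous_on_int_mult)

lemma int_mult_measurable: "int_mult (c i) \<in> borel_measurable \<mu>"
  by (intro continuous_measurable continuous_on_int_mult)

lemma continuous_coordinate_measurable:
  fixes g :: "'a \<Rightarrow> complex"
  shows "continuous_on UNIV g \<Longrightarrow> (\<lambda>x. g (x $ i)) \<in> borel_measurable \<kappa>"
  by (rule measurable_compose[OF coordinate_measurable borel_measurable_continuous_onI])

lemma int_mult_shift:
  fixes g :: "'a \<Rightarrow> complex"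
  assumes g: "continuous_on UNIV g"
  shows "(\<integral>u. g (int_mult (c i) u + a) \<partial>\<mu>) = (\<integral>u. g u \<partial>\<mu>)"
    and "L2_norm \<mu> (\<lambda>u. g (int_mult (c i) u + a)) = L2_norm \<mu> g"
proof -
  have ga: "continuous_on UNIV (\<lambda>u. g (a + u))"
    using g by (rule continuous_translate)
  have "(\<integral>u. g (a + int_mult (c i) u) \<partial>\<mu>) = (\<integral>u. g (a + u) \<partial>\<mu>)"
    by (rule integral_pushforward[OF distr_int_mult int_mult_measurable continuous_measurable[OF ga]])
  then show "(\<integral>u. g (int_mult (c i) u + a) \<partial>\<mu>) = (\<integral>u. g u \<partial>\<mu>)"
    using integral_add[OF continuous_measurable[OF g], of a] by (simp add: add.commute)
  have "L2_norm \<mu> (\<lambda>u. g (a + int_mult (c i) u)) = L2_norm \<mu> (\<lambda>u. g (a + u))"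
    by (rule L2_pushforward(2)[OF distr_int_mult int_mult_measurable continuous_L2[OF ga]])
  then show "L2_norm \<mu> (\<lambda>u. g (int_mult (c i) u + a)) = L2_norm \<mu> g"
    using L2_norm_translate[OF g, of a] by (simp add: add.commute)
qed

lemma prod_continuous_bounded:
  fixes g :: "'n \<Rightarrow> 'a \<Rightarrow> complex"
  assumes "\<And>i. continuous_on UNIV (g i)"
  obtains B where "\<And>J (x :: 'n \<Rightarrow> 'a). cmod (\<Prod>l\<in>J. g l (x l)) \<le> B"
proof -
  have "\<forall>i. \<exists>B. \<forall>x. cmod (g i x) \<le> B"
    using continuous_bounded[OF assms] by blast
  from choice[OF this] obtain B where B: "\<And>i x. cmod (g i x) \<le> B i"
    by blast
  have B0: "0 \<le> B i" for i
    using B[of i 0] norm_ge_zero order_trans by blast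
  \<comment> \<open>The maximum with 1 lets the product grow with the index set, so a single
    constant serves every \<open>J\<close>.\<close>
  have "cmod (\<Prod>l\<in>J. g l (x l)) \<le> (\<Prod>l\<in>UNIV. max 1 (B l))" for J and x :: "'n \<Rightarrow> 'a"
  proof -
    have "cmod (\<Prod>l\<in>J. g l (x l)) \<le> (\<Prod>l\<in>J. max 1 (B l))"
      unfolding prod_norm[symmetric] using B by (intro prod_mono) (auto simp: le_max_iff_disj)
    also have "\<dots> \<le> (\<Prod>l\<in>UNIV. max 1 (B l))"
      by (intro prod_mono2) (auto simp: B0)
    finally show ?thesis .
  qed
  then show ?thesis by (rule that)
qed

text \<open>The omitted coordinate \<open>i\<close> absorbs a translation of any other single coordinate.\<close>

lemma integral_prod_independent:
  fixes g :: "'n \<Rightarrow> 'a \<Rightarrow> complex"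
  assumes g: "\<And>l. continuous_on UNIV (g l)" and i: "i \<notin> J"
  shows "(\<integral>x. (\<Prod>l\<in>J. g l (x $ l)) \<partial>\<kappa>) = (\<Prod>l\<in>J. \<integral>u. g l u \<partial>\<mu>)"
proof -
  interpret \<kappa>: prob_space \<kappa> by (rule prob_kernel)
  have "finite J" by simp
  then show ?thesis
    using i
  proof (induction J rule: finite_induct)
    case empty
    show ?case using \<kappa>.prob_space by simp
  next
    case (insert j J)
    obtain B where B: "\<And>J (x :: 'n \<Rightarrow> 'a). cmod (\<Prod>l\<in>J. g l (x l)) \<le> B"
      by (rule prod_continuous_bounded[OF g], rule that)
    have ij: "i \<noteq> j" using insert.prems by auto
    define F where "F x = (\<Prod>l\<in>insert j J. g l (x $ l))" for x :: "'a ^ 'n"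
    \<comment> \<open>The vector is zero outside \<open>i\<close> and \<open>j\<close>, and neither
      of these lies in \<open>J\<close>.\<close>
    have F_shift: "F (kernel_vector c i j u + x) = g j (int_mult (c i) u + x $ j) * (\<Prod>l\<in>J. g l (x $ l))" for u x
    proof -
      have "(\<Prod>l\<in>J. g l ((kernel_vector c i j u + x) $ l)) = (\<Prod>l\<in>J. g l (x $ l))"
        using insert.hyps insert.prems by (intro prod.cong) (auto simp: kernel_vector_def)
      then show ?thesis
        using insert.hyps ij by (simp add: F_def kernel_vector_def)
    qed
    have J_meas: "(\<lambda>x. \<Prod>l\<in>J. g l (x $ l)) \<in> borel_measurable \<kappa>"
      by (intro borel_measurable_prod continuous_coordinate_measurable g)
    have "(\<lambda>z. g j (fst z $ j + int_mult (c i) (snd z))) \<in> borel_measurable (\<kappa> \<Otimes>\<^sub>M \<mu>)"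
      by (rule baire_measurableD[OF baire_measurable_add[OF coordinate_measurable
              borel_measurable_imp_baire_measurable[OF int_mult_measurable]] g])
    moreover have "(\<lambda>z. \<Prod>l\<in>J. g l (fst z $ l)) \<in> borel_measurable (\<kappa> \<Otimes>\<^sub>M \<mu>)"
      using measurable_compose[OF measurable_fst J_meas] .
    ultimately have meas: "(\<lambda>z. F (kernel_vector c i j (snd z) + fst z)) \<in> borel_measurable (\<kappa> \<Otimes>\<^sub>M \<mu>)"
      unfolding F_shift by (auto simp: add.commute)
    have "(\<integral>x. F x \<partial>\<kappa>) = (\<integral>x. (\<integral>u. F (kernel_vector c i j u + x) \<partial>\<mu>) \<partial>\<kappa>)"
    proof (rule haar_average[OF haar_kernel add_subgroup_form_kernel continuous_on_vec_add
            prob_space_axioms _ _ _ meas])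
      show "F \<in> borel_measurable \<kappa>"
        unfolding F_def by (intro borel_measurable_prod continuous_coordinate_measurable g)
      show "cmod (F x) \<le> B" for x
        unfolding F_def by (rule B)
    qed (rule kernel_vector_in_kernel[OF ij])
    also have "\<dots> = (\<integral>x. (\<integral>u. g j u \<partial>\<mu>) * (\<Prod>l\<in>J. g l (x $ l)) \<partial>\<kappa>)"
      unfolding F_shift by (simp add: int_mult_shift(1)[OF g])
    also have "\<dots> = (\<integral>u. g j u \<partial>\<mu>) * (\<Prod>l\<in>J. \<integral>u. g l u \<partial>\<mu>)"
      using insert by simp
    finally show ?case
      using insert.hyps by (simp add: F_def)
  qed
qed

text \<open>Independence is applied to the absolute values, which are continuous; total mass 1 then
  bounds each L^1 norm by the L^2 norm.\<close>

lemma integral_prod_norm_le: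
  assumes g: "\<And>l. continuous_on UNIV (g l)" and i: "i \<notin> J"
  shows "(\<integral>x. cmod (\<Prod>l\<in>J. g l (x $ l)) \<partial>\<kappa>) \<le> (\<Prod>l\<in>J. L2_norm \<mu> (g l))"
proof -
  have "complex_of_real (\<integral>x. cmod (\<Prod>l\<in>J. g l (x $ l)) \<partial>\<kappa>)
      = (\<integral>x. (\<Prod>l\<in>J. complex_of_real (cmod (g l (x $ l)))) \<partial>\<kappa>)"
    by (simp add: prod_norm[symmetric] flip: of_real_prod)
  also have "\<dots> = (\<Prod>l\<in>J. \<integral>u. complex_of_real (cmod (g l u)) \<partial>\<mu>)"
    by (rule integral_prod_independent[OF _ i]) (intro continuous_intros g)
  also have "\<dots> = complex_of_real (\<Prod>l\<in>J. \<integral>u. cmod (g l u) \<partial>\<mu>)"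
    by simp
  finally have "(\<integral>x. cmod (\<Prod>l\<in>J. g l (x $ l)) \<partial>\<kappa>) = (\<Prod>l\<in>J. \<integral>u. cmod (g l u) \<partial>\<mu>)"
    by (simp only: of_real_eq_iff)
  also have "\<dots> \<le> (\<Prod>l\<in>J. L2_norm \<mu> (g l))"
    by (intro prod_mono conjI integral_norm_le_L2_norm continuous_L2 g integral_nonneg_AE) auto
  finally show ?thesis .
qed

text \<open>Averaging over two kernel directions through \<open>i\<close> reduces the bound to
  \<open>bilinear_U2_bound\<close>, uniformly in the base point.\<close>

lemma solution_integral_continuous_bound:
  fixes g :: "'n \<Rightarrow> 'a \<Rightarrow> complex"
  assumes g: "\<And>l. continuous_on UNIV (g l)"
  shows "cmod (\<integral>x. (\<Prod>l\<in>UNIV. g l (x $ l)) \<partial>\<kappa>)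
    \<le> sqrt (sqrt (U2_energy (g i))) * (\<Prod>l\<in>UNIV - {i}. L2_norm \<mu> (g l))"
proof -
  interpret \<kappa>: prob_space \<kappa> by (rule prob_kernel)
  let ?P = "\<mu> \<Otimes>\<^sub>M \<mu>"
  obtain j where j: "j \<noteq> i"
    using obtain_other[of "{i}"] by auto
  obtain k where k: "k \<noteq> i" "k \<noteq> j"
    using obtain_other[of "{i, j}"] j by auto
  obtain B where B: "\<And>J (x :: 'n \<Rightarrow> 'a). cmod (\<Prod>l\<in>J. g l (x l)) \<le> B"
    by (rule prod_continuous_bounded[OF g], rule that)
  define J where "J = UNIV - {i, j, k}"
  have UNIV_eq: "UNIV = insert i (insert j (insert k J))"
    by (auto simp: J_def)
  have J: "i \<notin> J" "j \<notin> J" "k \<notin> J" "finite J"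
    by (auto simp: J_def)
  define A where "A x = (\<Prod>l\<in>J. g l (x $ l))" for x :: "'a ^ 'n"
  define F where "F x = (\<Prod>l\<in>UNIV. g l (x $ l))" for x :: "'a ^ 'n"
  define q where "q z = kernel_vector c i j (fst z) + kernel_vector c i k (snd z)" for z :: "'a \<times> 'a"
  have qK: "q z \<in> form_kernel c" for z
    using kernel_vector_in_kernel[of i j] kernel_vector_in_kernel[of i k] j k add_subgroup_form_kernel[of c]
    unfolding q_def add_subgroup_def by metis
  have F_eq: "F x = A x * (g i (x $ i) * g j (x $ j) * g k (x $ k))" for x
    unfolding F_def A_def by (subst UNIV_eq) (use J j k in simp)
  have A_shift: "A (q z + x) = A x" for z x
    unfolding A_def q_def by (intro prod.cong) (auto simp: J_def kernel_vector_def)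
  \<comment> \<open>\<open>T x z\<close> collects the three factors that move; the factor
    \<open>A x\<close> of the remaining coordinates is constant along both directions and leaves the
    inner integral.\<close>
  define T where "T x z = g i (x $ i + - int_mult (c j) (fst z) + - int_mult (c k) (snd z))
      * g j (int_mult (c i) (fst z) + x $ j) * g k (int_mult (c i) (snd z) + x $ k)"
    for x :: "'a ^ 'n" and z :: "'a \<times> 'a"
  have F_shift: "F (q z + x) = A x * T x z" for z x
    unfolding F_eq A_shift using j k by (simp add: q_def kernel_vector_def T_def algebra_simps)
  have A_meas: "A \<in> borel_measurable \<kappa>"
    unfolding A_def by (intro borel_measurable_prod continuous_coordinate_measurable g)
  have F_meas: "F \<in> borel_measurable \<kappa>"
    unfolding F_def by (intro borel_measurable_prod continuous_coordinate_measurable g)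
  have F_bound: "cmod (F x) \<le> B" and A_bound: "cmod (A x) \<le> B" for x
    unfolding F_def A_def by (rule B)+
  have minus_meas: "(\<lambda>u. - int_mult (c l) u) \<in> borel_measurable \<mu>" for l
    by (intro continuous_measurable continuous_intros continuous_on_int_mult)
  have Ti: "(\<lambda>z. g i (fst z $ i + (- int_mult (c j) (fst (snd z)) + - int_mult (c k) (snd (snd z)))))
      \<in> borel_measurable (\<kappa> \<Otimes>\<^sub>M ?P)"
    by (rule baire_measurableD[OF baire_measurable_add[OF coordinate_measurable
            baire_measurable_add[OF minus_meas borel_measurable_imp_baire_measurable[OF minus_meas]]] g])
  have Tj: "(\<lambda>z. g j (fst z $ j + int_mult (c i) (fst (snd z)))) \<in> borel_measurable (\<kappa> \<Otimes>\<^sub>M ?P)"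
    by (rule baire_measurableD[OF baire_measurable_add[OF coordinate_measurable
            borel_measurable_imp_baire_measurable[OF measurable_compose[OF measurable_fst int_mult_measurable]]] g])
  have Tk: "(\<lambda>z. g k (fst z $ k + int_mult (c i) (snd (snd z)))) \<in> borel_measurable (\<kappa> \<Otimes>\<^sub>M ?P)"
    by (rule baire_measurableD[OF baire_measurable_add[OF coordinate_measurable
            borel_measurable_imp_baire_measurable[OF measurable_compose[OF measurable_snd int_mult_measurable]]] g])
  have "(\<lambda>z. T (fst z) (snd z)) \<in> borel_measurable (\<kappa> \<Otimes>\<^sub>M ?P)"
    unfolding T_def using borel_measurable_times[OF borel_measurable_times[OF Ti Tj] Tk]
    by (simp add: algebra_simps)
  then have meas: "(\<lambda>z. F (q (snd z) + fst z)) \<in> borel_measurable (\<kappa> \<Otimes>\<^sub>M ?P)"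
    unfolding F_shift by (intro borel_measurable_times measurable_compose[OF measurable_fst A_meas])
  define b where "b = sqrt (sqrt (U2_energy (g i))) * L2_norm \<mu> (g j) * L2_norm \<mu> (g k)"
  have b0: "0 \<le> b"
    by (simp add: b_def U2_energy_nonneg L2_norm_nonneg)
  \<comment> \<open>The base point enters \<open>g i\<close> as the free translation
    \<open>v\<close> of \<open>bilinear_U2_bound\<close>, and the other two functions as shifts that
    preserve L^2 norms. Thus the bound does not depend on \<open>x\<close>.\<close>
  have T_bound: "cmod (\<integral>z. T x z \<partial>?P) \<le> b" for x
  proof -
    have shift: "continuous_on UNIV (\<lambda>u. g l (int_mult (c i) u + a))" for l a
      by (intro continuous_on_compose2[OF g[of l]] continuous_intros continuous_on_int_mult) auto
    show ?thesis
      unfolding T_def b_def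
      using bilinear_U2_bound[OF minus_meas distr_minus_int_mult minus_meas distr_minus_int_mult g shift shift]
      by (simp add: int_mult_shift(2)[OF g])
  qed
  have "(\<integral>x. F x \<partial>\<kappa>) = (\<integral>x. (\<integral>z. F (q z + x) \<partial>?P) \<partial>\<kappa>)"
    by (rule haar_average[OF haar_kernel add_subgroup_form_kernel continuous_on_vec_add
          prob_space_pair qK F_meas F_bound meas])
  also have "\<dots> = (\<integral>x. A x * (\<integral>z. T x z \<partial>?P) \<partial>\<kappa>)"
    unfolding F_shift by simp
  also have "cmod \<dots> \<le> (\<integral>x. cmod (A x) * b \<partial>\<kappa>)"
  proof (rule norm_integral_le_integral)
    have A_int: "integrable \<kappa> (\<lambda>x. cmod (A x))"
      by (rule \<kappa>.integrable_const_bound[of _ B]) (use A_meas A_bound in auto)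
    then show i1: "integrable \<kappa> (\<lambda>x. cmod (A x) * b)"
      by simp
    show le: "cmod (A x * (\<integral>z. T x z \<partial>?P)) \<le> cmod (A x) * b" for x
      unfolding norm_mult by (intro mult_left_mono T_bound) auto
    \<comment> \<open>Measurability in \<open>x\<close> comes from integrating out \<open>z\<close>
      in the jointly measurable \<open>F (q z + x)\<close>, which equals
      \<open>A x * T x z\<close>.\<close>
    have "sigma_finite_measure ?P"
      by (intro prob_space_imp_sigma_finite prob_space_pair)
    from sigma_finite_measure.borel_measurable_lebesgue_integral[OF this, of "\<lambda>x z. F (q z + x)" \<kappa>] meas
    have "(\<lambda>x. A x * (\<integral>z. T x z \<partial>?P)) \<in> borel_measurable \<kappa>"
      by (simp add: case_prod_unfold F_shift)
    then show "integrable \<kappa> (\<lambda>x. A x * (\<integral>z. T x z \<partial>?P))"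
      by (rule Bochner_Integration.integrable_bound[OF i1]) (use le b0 in auto)
  qed
  also have "\<dots> = (\<integral>x. cmod (A x) \<partial>\<kappa>) * b"
    by simp
  also have "\<dots> \<le> (\<Prod>l\<in>J. L2_norm \<mu> (g l)) * b"
    unfolding A_def using b0 J(1) by (intro mult_right_mono integral_prod_norm_le g)
  also have "\<dots> = sqrt (sqrt (U2_energy (g i))) * (\<Prod>l\<in>insert j (insert k J). L2_norm \<mu> (g l))"
    using J k by (simp add: b_def)
  also have "insert j (insert k J) = UNIV - {i}"
    using j k by (auto simp: J_def)
  finally show ?thesis
    by (simp add: F_def)
qed

text \<open>Weakening the U^2 factor to an L^2 factor gives the symmetric bound demanded by
  \<open>L2_bounded_form\<close>; any choice of \<open>i\<close> will do.\<close>

lemma solution_integral_continuous_L2_bound: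
  fixes g :: "'n \<Rightarrow> 'a \<Rightarrow> complex"
  assumes g: "\<And>l. continuous_on UNIV (g l)"
  shows "cmod (\<integral>x. (\<Prod>l\<in>UNIV. g l (x $ l)) \<partial>\<kappa>) \<le> (\<Prod>l\<in>UNIV. L2_norm \<mu> (g l))"
proof -
  fix i :: 'n
  have "cmod (\<integral>x. (\<Prod>l\<in>UNIV. g l (x $ l)) \<partial>\<kappa>)
      \<le> sqrt (sqrt (U2_energy (g i))) * (\<Prod>l\<in>UNIV - {i}. L2_norm \<mu> (g l))"
    using g by (rule solution_integral_continuous_bound)
  also have "\<dots> \<le> L2_norm \<mu> (g i) * (\<Prod>l\<in>UNIV - {i}. L2_norm \<mu> (g l))"
    by (intro mult_right_mono U2_energy_le g prod_nonneg) (simp add: L2_norm_nonneg)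
  also have "\<dots> = (\<Prod>l\<in>UNIV. L2_norm \<mu> (g l))"
    by (rule prod.remove[symmetric]) auto
  finally show ?thesis .
qed

end

section \<open>The U2 integral\<close>

lemma continuous_on_quadruple_add:
  "continuous_on UNIV ((+) (a :: 'a::topological_ab_group_add \<times> 'a \<times> 'a \<times> 'a))"
proof -
  have "(+) a = (\<lambda>v. (fst a + fst v, fst (snd a) + fst (snd v),
      fst (snd (snd a)) + fst (snd (snd v)), snd (snd (snd a)) + snd (snd (snd v))))"
    by (auto simp: fun_eq_iff plus_prod_def)
  moreover have "continuous_on UNIV \<dots>"
    by (intro continuous_intros)
  ultimately show ?thesis by simp
qed

text \<open>The four points at which the \<open>U\<^sup>2\<close> integrand evaluates its function are indexed by
  pairs of Booleans: the first component selects \<open>x\<close> or \<open>x'\<close>, the second \<open>y\<close> or \<open>y'\<close>.\<close>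

definition corner :: "bool \<times> bool \<Rightarrow> 'a \<times> 'a \<times> 'a \<times> 'a \<Rightarrow> 'a::ab_group_add" where
  "corner b = (\<lambda>(x, x', y, y'). (if fst b then x' else x) + (if snd b then y' else y))"

lemma prod_UNIV_bool_pair:
  "(\<Prod>b\<in>UNIV. u b) = u (False, False) * u (False, True) * u (True, False) * u (True, True)"
  for u :: "bool \<times> bool \<Rightarrow> 'c::comm_monoid_mult"
proof -
  have *: "(UNIV :: (bool \<times> bool) set) = {(False, False), (False, True), (True, False), (True, True)}"
    by (auto simp: UNIV_bool)
  show ?thesis
    unfolding * by (simp add: mult.assoc)
qed

lemma continuous_on_corner:
  "continuous_on UNIV (corner b :: _ \<Rightarrow> 'a::topological_ab_group_add)"
proof -
  have "corner b = (\<lambda>v::'a \<times> 'a \<times> 'a \<times> 'a. (if fst b then fst (snd v) else fst v)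
      + (if snd b then snd (snd (snd v)) else fst (snd (snd v))))"
    by (auto simp: corner_def fun_eq_iff)
  moreover have "continuous_on UNIV \<dots>"
    by (cases "fst b"; cases "snd b") (auto intro!: continuous_intros)
  ultimately show ?thesis by simp
qed

lemma corner_add: "corner b (v + w) = corner b v + corner b w"
  by (cases v; cases w) (auto simp: corner_def plus_prod_def algebra_simps)

lemma range_corner: "range (corner b) = UNIV"
proof -
  \<comment> \<open>With both first variables equal to \<open>a\<close> and both second ones 0, one
    witness serves all four corners.\<close>
  have "corner b (a, a, 0, 0) = a" for a :: 'a
    by (simp add: corner_def)
  then show ?thesis
    by (metis UNIV_eq_I rangeI)
qed

section \<open>Evaluation and continuity of the quadruple integral\<close>

locale quadruple_haar = compact_haar \<mu>
  for \<mu> :: "'a::{topological_ab_group_add,t2_space} measure" +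
  fixes \<nu> :: "('a \<times> 'a \<times> 'a \<times> 'a) measure"
  assumes haar_quadruple: "haar_probability UNIV \<nu>"
begin

lemma add_subgroup_UNIV: "add_subgroup UNIV"
  by (simp add: add_subgroup_def)

lemma corner_measurable: "corner b \<in> borel_measurable \<nu>"
  using haar_quadruple continuous_on_corner by (rule haar_probability_continuous_measurable)

lemma distr_corner: "distr \<nu> borel (corner b) = \<mu>"
  by (rule haar_pushforward[OF haar_quadruple add_subgroup_UNIV continuous_on_corner corner_add range_corner])

text \<open>The translation \<open>q u\<close> moves two corners by the same \<open>u\<close> and
  leaves \<open>R\<close> unchanged, so averaging over \<open>u\<close> merges the two factors into
  their correlation.\<close>

lemma quadruple_average:
  fixes g1 g2 :: "'a \<Rightarrow> complex" and R :: "'a \<times> 'a \<times> 'a \<times> 'a \<Rightarrow> complex"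
  assumes g: "continuous_on UNIV g1" "continuous_on UNIV g2"
    and R: "R \<in> borel_measurable \<nu>" "\<And>v. cmod (R v) \<le> C" "\<And>u v. R (q u + v) = R v"
    and q: "\<And>u v. corner b (q u + v) = corner b v + u" "\<And>u v. corner b' (q u + v) = corner b' v + u"
  shows "(\<integral>v. g1 (corner b v) * g2 (corner b' v) * R v \<partial>\<nu>)
    = (\<integral>v. corr g1 g2 (corner b v - corner b' v) * R v \<partial>\<nu>)"
proof -
  obtain B1 B2 where B: "\<And>x. cmod (g1 x) \<le> B1" "\<And>x. cmod (g2 x) \<le> B2"
    using continuous_bounded[OF g(1)] continuous_bounded[OF g(2)] by metis
  define F where "F v = g1 (corner b v) * g2 (corner b' v) * R v" for v
  have F_shift: "F (q u + v) = g1 (corner b v + u) * g2 (corner b' v + u) * R v" for u v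
    by (simp add: F_def q R(3))
  have F_bound: "cmod (F v) \<le> B1 * B2 * C" for v
    unfolding F_def norm_mult using B R(2)
    by (intro mult_mono mult_nonneg_nonneg) (auto intro: order_trans[OF norm_ge_zero])
  have F_meas: "F \<in> borel_measurable \<nu>"
    unfolding F_def
    by (intro borel_measurable_times R measurable_compose[OF corner_measurable]
        borel_measurable_continuous_onI g)
  have id: "baire_measurable \<mu> (\<lambda>u. u)"
    by (auto simp: baire_measurable_def intro: continuous_measurable)
  have meas: "(\<lambda>z. F (q (snd z) + fst z)) \<in> borel_measurable (\<nu> \<Otimes>\<^sub>M \<mu>)"
    unfolding F_shift
    by (intro borel_measurable_times measurable_compose[OF measurable_fst R(1)]
        baire_measurableD[OF baire_measurable_add[OF corner_measurable id]] g)
  have "(\<integral>v. F v \<partial>\<nu>) = (\<integral>v. (\<integral>u. F (q u + v) \<partial>\<mu>) \<partial>\<nu>)"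
    by (rule haar_average[OF haar_quadruple add_subgroup_UNIV continuous_on_quadruple_add
          prob_space_axioms _ F_meas F_bound meas]) simp
  also have "\<dots> = (\<integral>v. corr g1 g2 (corner b v - corner b' v) * R v \<partial>\<nu>)"
    unfolding F_shift by (simp add: corr_translate[OF g])
  finally show ?thesis
    by (simp add: F_def)
qed

text \<open>Averaging over \<open>y\<close> and then over \<open>y'\<close> leaves a function of \<open>x - x'\<close> alone.\<close>

lemma quadruple_integral:
  fixes g :: "bool \<times> bool \<Rightarrow> 'a \<Rightarrow> complex"
  assumes g: "\<And>b. continuous_on UNIV (g b)"
  shows "(\<integral>v. (\<Prod>b\<in>UNIV. g b (corner b v)) \<partial>\<nu>)
    = (\<integral>w. corr (g (False, False)) (g (True, False)) w * corr (g (False, True)) (g (True, True)) w \<partial>\<mu>)"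
proof -
  let ?c1 = "corr (g (False, False)) (g (True, False))" and ?c2 = "corr (g (False, True)) (g (True, True))"
  define d where "d v = fst v - fst (snd v)" for v :: "'a \<times> 'a \<times> 'a \<times> 'a"
  have d_cont: "continuous_on UNIV d"
    unfolding d_def by (intro continuous_intros)
  have d_meas: "d \<in> borel_measurable \<nu>"
    using haar_quadruple d_cont by (rule haar_probability_continuous_measurable)
  have d_corner: "corner (False, e) v - corner (True, e) v = d v" for e v
    by (cases v) (simp add: corner_def d_def)
  have c: "continuous_on UNIV ?c1" "continuous_on UNIV ?c2"
    by (intro continuous_corr g)+
  obtain B1 B2 where B: "\<And>x. cmod (g (False, True) x) \<le> B1" "\<And>x. cmod (g (True, True) x) \<le> B2"
    using continuous_bounded[OF g] by metis
  obtain C where C: "\<And>x. cmod (?c1 x) \<le> C"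
    using continuous_bounded[OF c(1)] by blast
  have gm: "(\<lambda>v. g b (corner b' v)) \<in> borel_measurable \<nu>" for b b'
    by (intro measurable_compose[OF corner_measurable] borel_measurable_continuous_onI g)
  have cm: "(\<lambda>v. ?c1 (d v)) \<in> borel_measurable \<nu>"
    by (intro measurable_compose[OF d_meas] borel_measurable_continuous_onI c)
  have "(\<integral>v. (\<Prod>b\<in>UNIV. g b (corner b v)) \<partial>\<nu>)
      = (\<integral>v. g (False, False) (corner (False, False) v) * g (True, False) (corner (True, False) v)
          * (g (False, True) (corner (False, True) v) * g (True, True) (corner (True, True) v)) \<partial>\<nu>)"
    by (simp add: prod_UNIV_bool_pair mult_ac)
  also have "\<dots> = (\<integral>v. ?c1 (corner (False, False) v - corner (True, False) v)
      * (g (False, True) (corner (False, True) v) * g (True, True) (corner (True, True) v)) \<partial>\<nu>)"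
  \<comment> \<open>This translation moves \<open>y\<close> alone, the variable shared by the
    corners with second component \<open>False\<close>; the other two corners contain only
    \<open>y'\<close>.\<close>
  proof (rule quadruple_average[OF g g, where q = "\<lambda>u. (0, 0, u, 0)" and C = "B1 * B2"])
    show "cmod (g (False, True) (corner (False, True) v) * g (True, True) (corner (True, True) v)) \<le> B1 * B2" for v
      unfolding norm_mult using B by (intro mult_mono) (auto intro: order_trans[OF norm_ge_zero])
    show "(\<lambda>v. g (False, True) (corner (False, True) v) * g (True, True) (corner (True, True) v))
        \<in> borel_measurable \<nu>"
      by (intro borel_measurable_times gm)
  qed (auto simp: corner_def plus_prod_def algebra_simps split_beta)
  also have "\<dots> = (\<integral>v. g (False, True) (corner (False, True) v) * g (True, True) (corner (True, True) v)
      * ?c1 (d v) \<partial>\<nu>)"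
    by (simp add: d_corner mult_ac)
  also have "\<dots> = (\<integral>v. ?c2 (corner (False, True) v - corner (True, True) v) * ?c1 (d v) \<partial>\<nu>)"
    by (rule quadruple_average[OF g g cm C, where q = "\<lambda>u. (0, 0, 0, u)"])
      (auto simp: corner_def d_def plus_prod_def algebra_simps split_beta)
  also have "\<dots> = (\<integral>v. (\<lambda>w. ?c1 w * ?c2 w) (d v) \<partial>\<nu>)"
    by (simp add: d_corner mult_ac)
  also have "\<dots> = (\<integral>w. ?c1 w * ?c2 w \<partial>\<mu>)"
  proof (rule integral_pushforward[OF _ d_meas])
    have "d (a, 0, 0, 0) = a" for a
      by (simp add: d_def)
    then have "range d = UNIV"
      by (metis UNIV_eq_I rangeI)
    then show "distr \<nu> borel d = \<mu>"
      by (intro haar_pushforward[OF haar_quadruple add_subgroup_UNIV d_cont]) (auto simp: d_def algebra_simps)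
    show "(\<lambda>w. ?c1 w * ?c2 w) \<in> borel_measurable \<mu>"
      by (intro continuous_measurable continuous_intros c)
  qed
  finally show ?thesis .
qed

text \<open>Four different functions are allowed because the extension to L^2 functions passes
  through mixed tuples. Each correlation is bounded pointwise by Cauchy-Schwarz.\<close>

lemma quadruple_integral_bound:
  fixes g :: "bool \<times> bool \<Rightarrow> 'a \<Rightarrow> complex"
  assumes g: "\<And>b. continuous_on UNIV (g b)"
  shows "cmod (\<integral>v. (\<Prod>b\<in>UNIV. g b (corner b v)) \<partial>\<nu>) \<le> (\<Prod>b\<in>UNIV. L2_norm \<mu> (g b))"
proof -
  let ?c1 = "corr (g (False, False)) (g (True, False))" and ?c2 = "corr (g (False, True)) (g (True, True))"
  let ?b = "(L2_norm \<mu> (g (False, False)) * L2_norm \<mu> (g (True, False)))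
    * (L2_norm \<mu> (g (False, True)) * L2_norm \<mu> (g (True, True)))"
  have "cmod (\<integral>w. ?c1 w * ?c2 w \<partial>\<mu>) \<le> (\<integral>w. ?b \<partial>\<mu>)"
  proof (rule norm_integral_le_integral)
    show "integrable \<mu> (\<lambda>w. ?c1 w * ?c2 w)"
      by (intro L2_space_mult_integrable continuous_L2 continuous_corr g)
    show "cmod (?c1 w * ?c2 w) \<le> ?b" for w
      unfolding norm_mult by (intro mult_mono corr_bound g) (auto simp: L2_norm_nonneg)
  qed simp
  also have "\<dots> = (\<Prod>b\<in>UNIV. L2_norm \<mu> (g b))"
    using prob_space by (simp add: prod_UNIV_bool_pair mult_ac)
  finally show ?thesis
    by (simp only: quadruple_integral[OF g])
qed

sublocale quadruple: L2_bounded_form \<mu> \<nu> corner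
  by (intro L2_bounded_form.intro L2_bounded_form_axioms.intro compact_haar_axioms
      haar_probability_prob_space[OF haar_quadruple] corner_measurable distr_corner quadruple_integral_bound)

text \<open>The conjugated factors of the U^2 integrand are those with exactly one primed variable,
  that is, with different Boolean components.\<close>

definition conj_pattern :: "('a \<Rightarrow> complex) \<Rightarrow> bool \<times> bool \<Rightarrow> 'a \<Rightarrow> complex" where
  "conj_pattern f b = (if fst b = snd b then f else (\<lambda>x. cnj (f x)))"

lemma U2_norm_conj_pattern:
  "U2_norm \<nu> f = root 4 (Re (\<integral>v. (\<Prod>b\<in>UNIV. conj_pattern f b (corner b v)) \<partial>\<nu>))"
  unfolding U2_norm_def
  by (intro arg_cong[of _ _ "\<lambda>z. root 4 (Re z)"] Bochner_Integration.integral_cong)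
    (auto simp: prod_UNIV_bool_pair conj_pattern_def corner_def)

text \<open>With this pattern of conjugates the second correlation is the conjugate of the first, so
  the quadruple integral is the integral of a squared modulus.\<close>

lemma U2_norm_continuous:
  assumes f: "continuous_on UNIV f"
  shows "U2_norm \<nu> f = sqrt (sqrt (U2_energy f))"
proof -
  have cf: "continuous_on UNIV (\<lambda>x. cnj (f x))"
    by (intro continuous_intros f)
  have c: "corr (\<lambda>x. cnj (f x)) f w = cnj (autocorr f w)" for w
    unfolding corr_def Bochner_Integration.integral_cnj[symmetric]
    by (simp del: Bochner_Integration.integral_cnj)
  have "(\<integral>v. (\<Prod>b\<in>UNIV. conj_pattern f b (corner b v)) \<partial>\<nu>) = (\<integral>w. autocorr f w * cnj (autocorr f w) \<partial>\<mu>)"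
    using f cf by (subst quadruple_integral) (auto simp: conj_pattern_def c)
  also have "\<dots> = (\<integral>w. complex_of_real ((cmod (autocorr f w))\<^sup>2) \<partial>\<mu>)"
    by (simp only: complex_norm_square)
  also have "\<dots> = complex_of_real (U2_energy f)"
    by (simp only: U2_energy_def integral_complex_of_real)
  \<comment> \<open>Writing 4 as \<open>2 * 2\<close> lets the fourth root split into two square
    roots.\<close>
  finally have "U2_norm \<nu> f = root (2 * 2) (U2_energy f)"
    by (simp add: U2_norm_conj_pattern)
  then show ?thesis
    by (simp only: real_root_mult_exp sqrt_def)
qed

text \<open>Continuity is that of the four-linear form: conjugation preserves L^2 distances, so all
  four entries converge together.\<close>

lemma tendsto_U2_norm:
  assumes F: "\<And>n. F n \<in> L2_space \<mu>" and f: "f \<in> L2_space \<mu>"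
    and lim: "(\<lambda>n. L2_norm \<mu> (\<lambda>x. F n x - f x)) \<longlonglongrightarrow> 0"
  shows "(\<lambda>n. U2_norm \<nu> (F n)) \<longlonglongrightarrow> U2_norm \<nu> f"
  unfolding U2_norm_conj_pattern
proof (intro tendsto_real_root tendsto_Re quadruple.form_tendsto)
  fix b :: "bool \<times> bool" and n
  show "conj_pattern (F n) b \<in> L2_space \<mu>" "conj_pattern f b \<in> L2_space \<mu>"
    using F f by (auto simp: conj_pattern_def intro: L2_space_cnj)
  have "L2_norm \<mu> (\<lambda>x. conj_pattern (F n) b x - conj_pattern f b x) = L2_norm \<mu> (\<lambda>x. F n x - f x)" for n
    using L2_norm_cnj[of \<mu> "\<lambda>x. F n x - f x"] by (simp add: conj_pattern_def)
  then show "(\<lambda>n. L2_norm \<mu> (\<lambda>x. conj_pattern (F n) b x - conj_pattern f b x)) \<longlonglongrightarrow> 0"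
    using lim by simp
qed

end

section \<open>Passage from continuous to square-integrable functions\<close>

theorem theorem2p5:
  fixes c :: "'n::finite \<Rightarrow> int"
    and \<mu> :: "'a::{topological_ab_group_add,t2_space} measure"
    and \<nu> :: "('a \<times> 'a \<times> 'a \<times> 'a) measure"
    and \<kappa> :: "('a ^ 'n) measure"
    and f :: "'n \<Rightarrow> 'a \<Rightarrow> complex"
  assumes "CARD('n) \<ge> 3"
    and "\<And>i. c i \<noteq> 0"
    and "compact (UNIV :: 'a set)"
    and "\<And>i. range (int_mult (c i) :: 'a \<Rightarrow> 'a) = UNIV"
    and "haar_probability UNIV \<mu>"
    and "haar_probability UNIV \<nu>"
    and "haar_probability (form_kernel c) \<kappa>"
    and "\<And>i. f i \<in> L2_space \<mu>"
  shows "integrable \<kappa> (\<lambda>x. \<Prod>i\<in>UNIV. f i (x $ i)) \<and>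
    cmod (solution_integral \<kappa> f)
      \<le> (MIN i. U2_norm \<nu> (f i) * (\<Prod>j\<in>UNIV - {i}. L2_norm \<mu> (f j)))"
proof -
  note f = \<open>\<And>i. f i \<in> L2_space \<mu>\<close>
  interpret kernel_haar \<mu> c \<kappa>
    using assms by unfold_locales
  interpret quadruple_haar \<mu> \<nu>
    using assms by unfold_locales
  interpret kernel: L2_bounded_form \<mu> \<kappa> "\<lambda>i x. x $ i"
    by (intro L2_bounded_form.intro L2_bounded_form_axioms.intro compact_haar_axioms
        prob_kernel coordinate_measurable distr_coordinate solution_integral_continuous_L2_bound)
  have "\<forall>i. \<exists>F. (\<forall>n. continuous_on UNIV (F n)) \<and> (\<lambda>n. L2_norm \<mu> (\<lambda>x. F n x - f i x)) \<longlonglongrightarrow> 0"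
  proof
    fix i
    obtain F where "\<And>n. continuous_on UNIV (F n)" "(\<lambda>n. L2_norm \<mu> (\<lambda>x. F n x - f i x)) \<longlonglongrightarrow> 0"
      by (rule continuous_approx_seq[OF f[of i]], rule that)
    then show "\<exists>F. (\<forall>n. continuous_on UNIV (F n)) \<and> (\<lambda>n. L2_norm \<mu> (\<lambda>x. F n x - f i x)) \<longlonglongrightarrow> 0"
      by blast
  qed
  from choice[OF this] obtain F
    where F: "\<forall>i. (\<forall>n. continuous_on UNIV (F i n)) \<and> (\<lambda>n. L2_norm \<mu> (\<lambda>x. F i n x - f i x)) \<longlonglongrightarrow> 0" ..
  have cont: "continuous_on UNIV (F i n)"
    and lim: "(\<lambda>n. L2_norm \<mu> (\<lambda>x. F i n x - f i x)) \<longlonglongrightarrow> 0" for i n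
    using F by simp_all
  have FL2: "F i n \<in> L2_space \<mu>" for i n
    using cont by (rule continuous_L2)
  \<comment> \<open>For each fixed \<open>i\<close> the inequality holds along the continuous
    approximants, and both sides converge: the left by continuity of the solution form, the right by
    continuity of the U^2 and L^2 norms.\<close>
  have "cmod (solution_integral \<kappa> f) \<le> U2_norm \<nu> (f i) * (\<Prod>j\<in>UNIV - {i}. L2_norm \<mu> (f j))" for i
  proof (rule LIMSEQ_le)
    show "(\<lambda>n. cmod (\<integral>x. (\<Prod>i\<in>UNIV. F i n (x $ i)) \<partial>\<kappa>)) \<longlonglongrightarrow> cmod (solution_integral \<kappa> f)"
      unfolding solution_integral_def by (intro tendsto_norm kernel.form_tendsto FL2 f lim)
    show "(\<lambda>n. U2_norm \<nu> (F i n) * (\<Prod>j\<in>UNIV - {i}. L2_norm \<mu> (F j n)))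
        \<longlonglongrightarrow> U2_norm \<nu> (f i) * (\<Prod>j\<in>UNIV - {i}. L2_norm \<mu> (f j))"
      by (intro tendsto_mult tendsto_prod tendsto_U2_norm tendsto_L2_norm FL2 f lim)
    show "\<exists>N. \<forall>n\<ge>N. cmod (\<integral>x. (\<Prod>i\<in>UNIV. F i n (x $ i)) \<partial>\<kappa>)
        \<le> U2_norm \<nu> (F i n) * (\<Prod>j\<in>UNIV - {i}. L2_norm \<mu> (F j n))"
      using solution_integral_continuous_bound[of "\<lambda>l. F l n" i for n, OF cont]
      unfolding U2_norm_continuous[OF cont] by blast
  qed
  \<comment> \<open>Integrability is what gives the inequality content, as the integral of a
    non-integrable function defaults to 0. The minimum is over a finite index type, so a bound for
    every \<open>i\<close> suffices.\<close>
  then show ?thesis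
    using kernel.form_integrable[OF f] by simp
qed

end
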